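(* Let $(M,\hat g,I_1,I_2,I_3)$ be an HKT-manifold with HKT-connection $D$, and suppose that a vector field $V$ generates a $D(2,1;-1)$-symmetry on it. Let $\hat\theta=\hat g(V,\cdot)$ be the dual 1-form of $V$. Then $-2\hat\theta$ is a potential 1-form for the HKT-manifold and is parallel with respect to $D$. In particular, local potential functions exist (that is, every point of $M$ has an open neighbourhood on which a potential function for the HKT-structure is defined).
   Context: A hypercomplex structure on a smooth manifold $M$ is a triple of integrable complex structures $I_1,I_2,I_3$ with $I_1^2=I_2^2=I_3^2=-\mathrm{Id}$ and $I_1I_2=I_3=-I_2I_1$. With a Riemannian metric $\hat g$ satisfying $\hat g(I_rX,I_rY)=\hat g(X,Y)$ for $r=1,2,3$, $(M,\hat g,I_1,I_2,I_3)$ is called hyperhermitian. The fundamental 2-forms are $\hat F_r(X,Y)=\hat g(I_rX,Y)$. An HKT-connection is a linear connection $D$ with torsion tensor $T^D$ such that $D\hat g=0$, $DI_1=DI_2=DI_3=0$, and $c(X,Y,Z)=\hat g(T^D(X,Y),Z)$ is a 3-form. When it exists it is unique, and $(M,\hat g,I_1,I_2,I_3)$ is then called an HKT-manifold (or HKT-space). A $D(2,1;-1)$-symmetry on an HKT-space is a vector field $V$ such that for all $r,s\in\{1,2,3\}$ $$\mathcal L_V\hat g=0,\quad \mathcal L_{I_rV}\hat g=0,\quad \mathcal L_{I_rV}I_s=\epsilon^{rst}I_t,$$ and whose dual 1-form $\hat\theta=\hat g(V,\cdot)$ is closed. Here $\epsilon^{rst}$ is the Levi-Civita symbol, with summation over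 $t$, and $\mathcal L$ is the Lie derivative. For a $k$-form $\omega$: $(I_r\omega)(X_1,\dots,X_k)=(-1)^k\omega(I_rX_1,\dots,I_rX_k)$ and $d_r\omega=(-1)^kI_r\,d\,I_r\omega$. A 1-form $\omega$ is a potential 1-form if, with $\omega_r=I_r\omega$, $$\hat F_1=\tfrac12(d\omega_1+d_2\omega_3),\quad \hat F_2=\tfrac12(d\omega_2+d_3\omega_1),\quad \hat F_3=\tfrac12(d\omega_3+d_1\omega_2).$$ A function $\mu$ on an open set $U\subseteq M$ is a potential function if on $U$ $$\hat F_1=\tfrac12(dd_1+d_2d_3)\mu,\quad \hat F_2=\tfrac12(dd_2+d_3d_1)\mu,\quad \hat F_3=\tfrac12(dd_3+d_1d_2)\mu.$$ *)

theory Defs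
  imports "HOL-Analysis.Analysis"
begin

section \<open>Smooth maps between normed spaces\<close>

primrec k_smooth_on ::
  "nat \<Rightarrow> 'a::real_normed_vector set \<Rightarrow> ('a \<Rightarrow> 'b::real_normed_vector) \<Rightarrow> bool" where
  "k_smooth_on 0 S f \<longleftrightarrow> continuous_on S f"
| "k_smooth_on (Suc k) S f \<longleftrightarrow> (\<forall>x\<in>S. f differentiable (at x)) \<and>
     (\<forall>v. k_smooth_on k S (\<lambda>x. frechet_derivative f (at x) v))"

(* Only used for open S. *)
definition smooth_on :: "'a::real_normed_vector set \<Rightarrow> ('a \<Rightarrow> 'b::real_normed_vector) \<Rightarrow> bool" where
  "smooth_on S f \<longleftrightarrow> (\<forall>k. k_smooth_on k S f)"


section \<open>Smooth manifolds\<close>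

text \<open>
  The manifold is a whole type \<open>'m\<close> of class \<open>t2_space\<close> and \<open>second_countable_topology\<close>, together
  with a smooth atlas \<open>A\<close> modelled on a Euclidean space \<open>'e\<close>. A chart is a pair of its domain and
  its coordinate map. The atlas need not be maximal.
\<close>

type_synonym ('m, 'e) chart = "'m set \<times> ('m \<Rightarrow> 'e)"

definition smooth_atlas ::
  "('m::{t2_space, second_countable_topology}, 'e::euclidean_space) chart set \<Rightarrow> bool" where
  "smooth_atlas A \<longleftrightarrow>
     (\<Union>(W, \<phi>)\<in>A. W) = UNIV \<and>
     (\<forall>(W, \<phi>)\<in>A. open W \<and> open (\<phi> ` W) \<and>
        homeomorphism W (\<phi> ` W) \<phi> (inv_into W \<phi>)) \<and>
     (\<forall>(W, \<phi>)\<in>A. \<forall>(W', \<psi>)\<in>A. smooth_on (\<phi> ` (W \<inter> W')) (\<psi> \<circ> inv_into W \<phi>))"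

definition smooth_funs ::
  "('m::{t2_space, second_countable_topology}, 'e::euclidean_space) chart set \<Rightarrow> 'm set
     \<Rightarrow> ('m \<Rightarrow> real) set" where
  "smooth_funs A U = {f. \<forall>(W, \<phi>)\<in>A. smooth_on (\<phi> ` (W \<inter> U)) (f \<circ> inv_into W \<phi>)}"

definition smooth_near ::
  "('m::{t2_space, second_countable_topology}, 'e::euclidean_space) chart set \<Rightarrow> 'm
     \<Rightarrow> ('m \<Rightarrow> real) \<Rightarrow> bool" where
  "smooth_near A p f \<longleftrightarrow> (\<exists>U. open U \<and> p \<in> U \<and> f \<in> smooth_funs A U)"


section \<open>Tangent vectors and vector fields\<close>

text \<open>
  A tangent vector at \<open>p\<close> is a directional derivative acting on the functions that are smooth near
  \<open>p\<close>. Functions that are not smooth near \<open>p\<close> are sent to \<open>0\<close>, so that a tangent vector is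
  determined by its action on germs of smooth functions. Linear combinations of tangent vectors are
  taken pointwise.
\<close>

type_synonym 'm tvec = "('m \<Rightarrow> real) \<Rightarrow> real"
type_synonym 'm vfield = "'m \<Rightarrow> 'm tvec"

definition coord_tvec ::
  "('m::{t2_space, second_countable_topology}, 'e::euclidean_space) chart set \<Rightarrow> ('m, 'e) chart
     \<Rightarrow> 'm \<Rightarrow> 'e \<Rightarrow> 'm tvec" where
  "coord_tvec A c p w = (\<lambda>f. if smooth_near A p f
     then frechet_derivative (f \<circ> inv_into (fst c) (snd c)) (at (snd c p)) w else 0)"

definition tangent_space ::
  "('m::{t2_space, second_countable_topology}, 'e::euclidean_space) chart set \<Rightarrow> 'm
     \<Rightarrow> 'm tvec set" where
  "tangent_space A p = {coord_tvec A c p w | c w. c \<in> A \<and> p \<in> fst c}"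

definition vfields ::
  "('m::{t2_space, second_countable_topology}, 'e::euclidean_space) chart set \<Rightarrow> 'm set
     \<Rightarrow> 'm vfield set" where
  "vfields A U = {X. (\<forall>p\<in>U. X p \<in> tangent_space A p) \<and>
     (\<forall>W f. open W \<longrightarrow> W \<subseteq> U \<longrightarrow> f \<in> smooth_funs A W \<longrightarrow> (\<lambda>p. X p f) \<in> smooth_funs A W)}"

definition lie_bracket ::
  "('m::{t2_space, second_countable_topology}, 'e::euclidean_space) chart set
     \<Rightarrow> 'm vfield \<Rightarrow> 'm vfield \<Rightarrow> 'm vfield" where
  "lie_bracket A X Y = (\<lambda>p f. if smooth_near A p f
     then X p (\<lambda>q. Y q f) - Y p (\<lambda>q. X q f) else 0)"


section \<open>Endomorphism fields and Riemannian metrics\<close>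

type_synonym 'm endo = "'m \<Rightarrow> 'm tvec \<Rightarrow> 'm tvec"
type_synonym 'm metric = "'m \<Rightarrow> 'm tvec \<Rightarrow> 'm tvec \<Rightarrow> real"

definition apply_endo :: "'m endo \<Rightarrow> 'm vfield \<Rightarrow> 'm vfield" where
  "apply_endo J X = (\<lambda>p. J p (X p))"

definition endo_field ::
  "('m::{t2_space, second_countable_topology}, 'e::euclidean_space) chart set
     \<Rightarrow> 'm endo \<Rightarrow> bool" where
  "endo_field A J \<longleftrightarrow>
     (\<forall>p. \<forall>u\<in>tangent_space A p. J p u \<in> tangent_space A p \<and>
        (\<forall>v\<in>tangent_space A p. \<forall>a b.
           J p (\<lambda>f. a * u f + b * v f) = (\<lambda>f. a * J p u f + b * J p v f))) \<and>
     (\<forall>U. open U \<longrightarrow> (\<forall>X\<in>vfields A U. apply_endo J X \<in> vfields A U))"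

definition riemannian_metric ::
  "('m::{t2_space, second_countable_topology}, 'e::euclidean_space) chart set
     \<Rightarrow> 'm metric \<Rightarrow> bool" where
  "riemannian_metric A g \<longleftrightarrow>
     (\<forall>p. \<forall>u\<in>tangent_space A p. \<forall>v\<in>tangent_space A p.
        g p u v = g p v u \<and>
        (\<forall>w\<in>tangent_space A p. \<forall>a b.
           g p (\<lambda>f. a * u f + b * v f) w = a * g p u w + b * g p v w)) \<and>
     (\<forall>p. \<forall>u\<in>tangent_space A p. u \<noteq> (\<lambda>f. 0) \<longrightarrow> g p u u > 0) \<and>
     (\<forall>U. open U \<longrightarrow> (\<forall>X\<in>vfields A U. \<forall>Y\<in>vfields A U.
        (\<lambda>p. g p (X p) (Y p)) \<in> smooth_funs A U))"


section \<open>Hyperhermitian structures\<close>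

text \<open>The triple of complex structures is \<open>I 1\<close>, \<open>I 2\<close>, \<open>I 3\<close>; other indices are irrelevant.\<close>

definition nijenhuis ::
  "('m::{t2_space, second_countable_topology}, 'e::euclidean_space) chart set
     \<Rightarrow> 'm endo \<Rightarrow> 'm vfield \<Rightarrow> 'm vfield \<Rightarrow> 'm vfield" where
  "nijenhuis A J X Y = (\<lambda>p f.
     lie_bracket A (apply_endo J X) (apply_endo J Y) p f
     - J p (lie_bracket A (apply_endo J X) Y p) f
     - J p (lie_bracket A X (apply_endo J Y) p) f
     - lie_bracket A X Y p f)"

definition integrable_complex_structure ::
  "('m::{t2_space, second_countable_topology}, 'e::euclidean_space) chart set
     \<Rightarrow> 'm endo \<Rightarrow> bool" where
  "integrable_complex_structure A J \<longleftrightarrow>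
     endo_field A J \<and>
     (\<forall>p. \<forall>u\<in>tangent_space A p. J p (J p u) = (\<lambda>f. - u f)) \<and>
     (\<forall>U. open U \<longrightarrow> (\<forall>X\<in>vfields A U. \<forall>Y\<in>vfields A U. \<forall>p\<in>U.
        nijenhuis A J X Y p = (\<lambda>f. 0)))"

definition hypercomplex_structure ::
  "('m::{t2_space, second_countable_topology}, 'e::euclidean_space) chart set
     \<Rightarrow> (nat \<Rightarrow> 'm endo) \<Rightarrow> bool" where
  "hypercomplex_structure A I \<longleftrightarrow>
     (\<forall>r\<in>{1,2,3}. integrable_complex_structure A (I r)) \<and>
     (\<forall>p. \<forall>u\<in>tangent_space A p.
        I 1 p (I 2 p u) = I 3 p u \<and> I 3 p u = (\<lambda>f. - I 2 p (I 1 p u) f))"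

definition hyperhermitian ::
  "('m::{t2_space, second_countable_topology}, 'e::euclidean_space) chart set
     \<Rightarrow> 'm metric \<Rightarrow> (nat \<Rightarrow> 'm endo) \<Rightarrow> bool" where
  "hyperhermitian A g I \<longleftrightarrow>
     smooth_atlas A \<and> hypercomplex_structure A I \<and> riemannian_metric A g \<and>
     (\<forall>r\<in>{1,2,3}. \<forall>p. \<forall>u\<in>tangent_space A p. \<forall>v\<in>tangent_space A p.
        g p (I r p u) (I r p v) = g p u v)"


section \<open>Linear connections and HKT-manifolds\<close>

text \<open>
  A connection acts on vector fields over arbitrary open sets, compatibly with restriction; since
  vector fields are total functions, the last condition says that the values of \<open>D X Y\<close> on \<open>U\<close>
  only depend on \<open>X\<close> and \<open>Y\<close> on \<open>U\<close>.
\<close>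

type_synonym 'm connection = "'m vfield \<Rightarrow> 'm vfield \<Rightarrow> 'm vfield"

definition linear_connection ::
  "('m::{t2_space, second_countable_topology}, 'e::euclidean_space) chart set
     \<Rightarrow> 'm connection \<Rightarrow> bool" where
  "linear_connection A D \<longleftrightarrow> (\<forall>U. open U \<longrightarrow>
     (\<forall>X\<in>vfields A U. \<forall>X'\<in>vfields A U. \<forall>Y\<in>vfields A U. \<forall>Y'\<in>vfields A U. \<forall>h\<in>smooth_funs A U.
        D X Y \<in> vfields A U \<and>
        (\<forall>p\<in>U. D (\<lambda>q f. h q * X q f + X' q f) Y p = (\<lambda>f. h p * D X Y p f + D X' Y p f)) \<and>
        (\<forall>p\<in>U. D X (\<lambda>q f. Y q f + Y' q f) p = (\<lambda>f. D X Y p f + D X Y' p f)) \<and>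
        (\<forall>p\<in>U. D X (\<lambda>q f. h q * Y q f) p = (\<lambda>f. X p h * Y p f + h p * D X Y p f)) \<and>
        ((\<forall>p\<in>U. X p = X' p \<and> Y p = Y' p) \<longrightarrow> (\<forall>p\<in>U. D X Y p = D X' Y' p))))"

definition torsion ::
  "('m::{t2_space, second_countable_topology}, 'e::euclidean_space) chart set
     \<Rightarrow> 'm connection \<Rightarrow> 'm vfield \<Rightarrow> 'm vfield \<Rightarrow> 'm vfield" where
  "torsion A D X Y = (\<lambda>p f. D X Y p f - D Y X p f - lie_bracket A X Y p f)"

definition parallel_metric ::
  "('m::{t2_space, second_countable_topology}, 'e::euclidean_space) chart set
     \<Rightarrow> 'm connection \<Rightarrow> 'm metric \<Rightarrow> bool" where
  "parallel_metric A D g \<longleftrightarrow> (\<forall>U. open U \<longrightarrow>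
     (\<forall>X\<in>vfields A U. \<forall>Y\<in>vfields A U. \<forall>Z\<in>vfields A U. \<forall>p\<in>U.
        X p (\<lambda>q. g q (Y q) (Z q)) - g p (D X Y p) (Z p) - g p (Y p) (D X Z p) = 0))"

definition parallel_endo ::
  "('m::{t2_space, second_countable_topology}, 'e::euclidean_space) chart set
     \<Rightarrow> 'm connection \<Rightarrow> 'm endo \<Rightarrow> bool" where
  "parallel_endo A D J \<longleftrightarrow> (\<forall>U. open U \<longrightarrow>
     (\<forall>X\<in>vfields A U. \<forall>Y\<in>vfields A U. \<forall>p\<in>U.
        (\<lambda>f. D X (apply_endo J Y) p f - J p (D X Y p) f) = (\<lambda>f. 0)))"

text \<open>
  The trilinear expression \<open>g (torsion X Y) Z\<close> is linear over smooth functions for every linear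
  connection, so it is a 3-form if and only if it is alternating.
\<close>

definition torsion_3form ::
  "('m::{t2_space, second_countable_topology}, 'e::euclidean_space) chart set
     \<Rightarrow> 'm metric \<Rightarrow> 'm connection \<Rightarrow> 'm vfield \<Rightarrow> 'm vfield \<Rightarrow> 'm vfield \<Rightarrow> 'm \<Rightarrow> real" where
  "torsion_3form A g D X Y Z p = g p (torsion A D X Y p) (Z p)"

definition hkt_connection ::
  "('m::{t2_space, second_countable_topology}, 'e::euclidean_space) chart set
     \<Rightarrow> 'm metric \<Rightarrow> (nat \<Rightarrow> 'm endo) \<Rightarrow> 'm connection \<Rightarrow> bool" where
  "hkt_connection A g I D \<longleftrightarrow>
     linear_connection A D \<and> parallel_metric A D g \<and>
     (\<forall>r\<in>{1,2,3}. parallel_endo A D (I r)) \<and>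
     (\<forall>U. open U \<longrightarrow> (\<forall>X\<in>vfields A U. \<forall>Y\<in>vfields A U. \<forall>Z\<in>vfields A U. \<forall>p\<in>U.
        torsion_3form A g D X Y Z p = - torsion_3form A g D Y X Z p \<and>
        torsion_3form A g D X Y Z p = - torsion_3form A g D X Z Y p))"

definition hkt_manifold ::
  "('m::{t2_space, second_countable_topology}, 'e::euclidean_space) chart set
     \<Rightarrow> 'm metric \<Rightarrow> (nat \<Rightarrow> 'm endo) \<Rightarrow> bool" where
  "hkt_manifold A g I \<longleftrightarrow> hyperhermitian A g I \<and> (\<exists>D. hkt_connection A g I D)"


section \<open>Differential forms\<close>

text \<open>
  Forms are represented by their evaluation on vector fields over open sets. Functions are 0-forms,
  on which \<open>I\<^sub>r\<close> acts as the identity; only degrees up to 2 occur.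
\<close>

type_synonym 'm form1 = "'m vfield \<Rightarrow> 'm \<Rightarrow> real"
type_synonym 'm form2 = "'m vfield \<Rightarrow> 'm vfield \<Rightarrow> 'm \<Rightarrow> real"

definition one_form ::
  "('m::{t2_space, second_countable_topology}, 'e::euclidean_space) chart set
     \<Rightarrow> 'm form1 \<Rightarrow> bool" where
  "one_form A \<omega> \<longleftrightarrow> (\<forall>U. open U \<longrightarrow>
     (\<forall>X\<in>vfields A U. \<forall>Y\<in>vfields A U. \<forall>h\<in>smooth_funs A U.
        \<omega> X \<in> smooth_funs A U \<and>
        (\<forall>p\<in>U. \<omega> (\<lambda>q f. h q * X q f + Y q f) p = h p * \<omega> X p + \<omega> Y p) \<and>
        ((\<forall>p\<in>U. X p = Y p) \<longrightarrow> (\<forall>p\<in>U. \<omega> X p = \<omega> Y p))))"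

definition form2_eq_on ::
  "('m::{t2_space, second_countable_topology}, 'e::euclidean_space) chart set \<Rightarrow> 'm set
     \<Rightarrow> 'm form2 \<Rightarrow> 'm form2 \<Rightarrow> bool" where
  "form2_eq_on A U \<alpha> \<beta> \<longleftrightarrow> (\<forall>W. open W \<longrightarrow> W \<subseteq> U \<longrightarrow>
     (\<forall>X\<in>vfields A W. \<forall>Y\<in>vfields A W. \<forall>p\<in>W. \<alpha> X Y p = \<beta> X Y p))"

definition fundamental_form :: "'m metric \<Rightarrow> 'm endo \<Rightarrow> 'm form2" where
  "fundamental_form g J X Y p = g p (J p (X p)) (Y p)"

definition dual_form :: "'m metric \<Rightarrow> 'm vfield \<Rightarrow> 'm form1" where
  "dual_form g V X p = g p (V p) (X p)"

definition ext_d0 :: "('m \<Rightarrow> real) \<Rightarrow> 'm form1" where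
  "ext_d0 \<mu> X p = X p \<mu>"

definition ext_d1 ::
  "('m::{t2_space, second_countable_topology}, 'e::euclidean_space) chart set
     \<Rightarrow> 'm form1 \<Rightarrow> 'm form2" where
  "ext_d1 A \<omega> X Y p = X p (\<omega> Y) - Y p (\<omega> X) - \<omega> (lie_bracket A X Y) p"

definition act_form1 :: "'m endo \<Rightarrow> 'm form1 \<Rightarrow> 'm form1" where
  "act_form1 J \<omega> X p = - \<omega> (apply_endo J X) p"

definition act_form2 :: "'m endo \<Rightarrow> 'm form2 \<Rightarrow> 'm form2" where
  "act_form2 J \<alpha> X Y p = \<alpha> (apply_endo J X) (apply_endo J Y) p"

text \<open>The operators \<open>d\<^sub>r = (-1)\<^sup>k I\<^sub>r d I\<^sub>r\<close> on \<open>k\<close>-forms for \<open>k = 0\<close> and \<open>k = 1\<close>.\<close>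

definition twisted_d0 :: "'m endo \<Rightarrow> ('m \<Rightarrow> real) \<Rightarrow> 'm form1" where
  "twisted_d0 J \<mu> = act_form1 J (ext_d0 \<mu>)"

definition twisted_d1 ::
  "('m::{t2_space, second_countable_topology}, 'e::euclidean_space) chart set
     \<Rightarrow> 'm endo \<Rightarrow> 'm form1 \<Rightarrow> 'm form2" where
  "twisted_d1 A J \<omega> X Y p = - act_form2 J (ext_d1 A (act_form1 J \<omega>)) X Y p"

definition parallel_form1 ::
  "('m::{t2_space, second_countable_topology}, 'e::euclidean_space) chart set
     \<Rightarrow> 'm connection \<Rightarrow> 'm form1 \<Rightarrow> bool" where
  "parallel_form1 A D \<omega> \<longleftrightarrow> (\<forall>U. open U \<longrightarrow>
     (\<forall>X\<in>vfields A U. \<forall>Y\<in>vfields A U. \<forall>p\<in>U. X p (\<omega> Y) - \<omega> (D X Y) p = 0))"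


section \<open>Potentials\<close>

definition potential_1form ::
  "('m::{t2_space, second_countable_topology}, 'e::euclidean_space) chart set
     \<Rightarrow> 'm metric \<Rightarrow> (nat \<Rightarrow> 'm endo) \<Rightarrow> 'm form1 \<Rightarrow> bool" where
  "potential_1form A g I \<omega> \<longleftrightarrow> one_form A \<omega> \<and>
     (\<forall>(r, s, t)\<in>{(1,2,3), (2,3,1), (3,1,2)}.
        form2_eq_on A UNIV (fundamental_form g (I r))
          (\<lambda>X Y p. 1 / 2 * (ext_d1 A (act_form1 (I r) \<omega>) X Y p
                          + twisted_d1 A (I s) (act_form1 (I t) \<omega>) X Y p)))"

definition potential_function ::
  "('m::{t2_space, second_countable_topology}, 'e::euclidean_space) chart set
     \<Rightarrow> 'm metric \<Rightarrow> (nat \<Rightarrow> 'm endo) \<Rightarrow> 'm set \<Rightarrow> ('m \<Rightarrow> real) \<Rightarrow> bool" where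
  "potential_function A g I U \<mu> \<longleftrightarrow> \<mu> \<in> smooth_funs A U \<and>
     (\<forall>(r, s, t)\<in>{(1,2,3), (2,3,1), (3,1,2)}.
        form2_eq_on A U (fundamental_form g (I r))
          (\<lambda>X Y p. 1 / 2 * (ext_d1 A (twisted_d0 (I r) \<mu>) X Y p
                          + twisted_d1 A (I s) (twisted_d0 (I t) \<mu>) X Y p)))"


section \<open>Lie derivatives and the symmetry\<close>

definition lie_metric ::
  "('m::{t2_space, second_countable_topology}, 'e::euclidean_space) chart set
     \<Rightarrow> 'm vfield \<Rightarrow> 'm metric \<Rightarrow> 'm form2" where
  "lie_metric A V g X Y p = V p (\<lambda>q. g q (X q) (Y q))
     - g p (lie_bracket A V X p) (Y p) - g p (X p) (lie_bracket A V Y p)"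

definition lie_endo ::
  "('m::{t2_space, second_countable_topology}, 'e::euclidean_space) chart set
     \<Rightarrow> 'm vfield \<Rightarrow> 'm endo \<Rightarrow> 'm vfield \<Rightarrow> 'm vfield" where
  "lie_endo A V J X = (\<lambda>p f.
     lie_bracket A V (apply_endo J X) p f - J p (lie_bracket A V X p) f)"

definition killing ::
  "('m::{t2_space, second_countable_topology}, 'e::euclidean_space) chart set
     \<Rightarrow> 'm metric \<Rightarrow> 'm vfield \<Rightarrow> bool" where
  "killing A g V \<longleftrightarrow> (\<forall>U. open U \<longrightarrow>
     (\<forall>X\<in>vfields A U. \<forall>Y\<in>vfields A U. \<forall>p\<in>U. lie_metric A V g X Y p = 0))"

definition levi_civita :: "nat \<Rightarrow> nat \<Rightarrow> nat \<Rightarrow> real" where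
  "levi_civita r s t =
     (if (r, s, t) \<in> {(1,2,3), (2,3,1), (3,1,2)} then 1
      else if (r, s, t) \<in> {(1,3,2), (3,2,1), (2,1,3)} then - 1 else 0)"

definition D21_symmetry ::
  "('m::{t2_space, second_countable_topology}, 'e::euclidean_space) chart set
     \<Rightarrow> 'm metric \<Rightarrow> (nat \<Rightarrow> 'm endo) \<Rightarrow> 'm vfield \<Rightarrow> bool" where
  "D21_symmetry A g I V \<longleftrightarrow>
     V \<in> vfields A UNIV \<and>
     killing A g V \<and>
     (\<forall>r\<in>{1,2,3}. killing A g (apply_endo (I r) V)) \<and>
     (\<forall>r\<in>{1,2,3}. \<forall>s\<in>{1,2,3}. \<forall>U. open U \<longrightarrow> (\<forall>X\<in>vfields A U. \<forall>p\<in>U.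
        lie_endo A (apply_endo (I r) V) (I s) X p
          = (\<lambda>f. \<Sum>t\<in>{1,2,3}. levi_civita r s t * I t p (X p) f))) \<and>
     form2_eq_on A UNIV (ext_d1 A (dual_form g V)) (\<lambda>X Y p. 0)"

end

theory Submission
  imports Defs
begin

text \<open>
  Write \<open>T\<close> for the torsion of \<open>D\<close>, \<open>c(X,Y,Z) = g(T(X,Y),Z)\<close> and \<open>B(X,Y) = g(D\<^sub>X V, Y)\<close>. As \<open>c\<close> is
  alternating and \<open>D g = 0\<close>, a field is Killing if and only if its \<open>D\<close>-derivative is skew. For \<open>V\<close> and
  \<open>I\<^sub>r V\<close> this gives \<open>B(I\<^sub>r X, I\<^sub>r Y) = - B(X,Y)\<close> for \<open>r = 1, 2, 3\<close>; since \<open>I\<^sub>3 = I\<^sub>1 I\<^sub>2\<close>, also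
  \<open>B(I\<^sub>3 X, I\<^sub>3 Y) = B(X,Y)\<close>, so \<open>B = 0\<close> and \<open>V\<close> and all \<open>I\<^sub>r V\<close> are parallel. The exterior derivative of
  the dual form of \<open>I\<^sub>r V\<close> is then \<open>c(I\<^sub>r V, _, _)\<close>, and the bracket relation for the Lie derivative of
  \<open>I\<^sub>s\<close> along \<open>I\<^sub>r V\<close> reads \<open>c(I\<^sub>r V, I\<^sub>s X, I\<^sub>s Y) - c(I\<^sub>r V, X, Y) = g(I\<^sub>r X, Y)\<close> for cyclic \<open>(r,s,t)\<close>,
  which is the potential equation. A local potential function is a primitive of the closed form \<open>-2\<theta>\<close>
  on a coordinate ball.
\<close>

section \<open>Calculus of smooth maps\<close>

lemma k_smooth_on_subset:
  assumes "k_smooth_on k S f" "T \<subseteq> S"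
  shows "k_smooth_on k T f"
  using assms
proof (induction k arbitrary: f)
  case 0 then show ?case by (auto intro: continuous_on_subset)
next
  case (Suc k) then show ?case by auto
qed

lemma k_smooth_on_SucD:
  assumes "k_smooth_on (Suc k) S f"
  shows "k_smooth_on k S f"
  using assms
proof (induction k arbitrary: f)
  case 0 then show ?case
    by (auto simp: continuous_on_eq_continuous_at intro!: continuous_at_imp_continuous_on
        differentiable_imp_continuous_within)
next
  case (Suc k) then show ?case by auto
qed

text \<open>Functions that agree on an open set have the same Frechet derivative at each of its
  points, so the induction passes to the derivatives. Openness matters because
  \<open>frechet_derivative\<close> looks at a full neighbourhood.\<close>

lemma k_smooth_on_cong:
  assumes "open S" "\<And>x. x \<in> S \<Longrightarrow> f x = h x" "k_smooth_on k S f"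
  shows "k_smooth_on k S h"
  using assms(2,3)
proof (induction k arbitrary: f h)
  case 0 then show ?case using continuous_on_cong by (metis k_smooth_on.simps(1))
next
  case (Suc k)
  have d: "f differentiable (at x)" if "x \<in> S" for x using Suc.prems(2) that by simp
  have e: "frechet_derivative f (at x) = frechet_derivative h (at x)" if "x \<in> S" for x
    using frechet_derivative_transform_within_open[OF d[OF that] \<open>open S\<close> that] Suc.prems(1) by blast
  have "h differentiable (at x)" if "x \<in> S" for x
  proof -
    have "(f has_derivative frechet_derivative f (at x)) (at x)"
      using d[OF that] frechet_derivative_works by blast
    then have "(h has_derivative frechet_derivative f (at x)) (at x)"
      by (rule has_derivative_transform_within_open[OF _ \<open>open S\<close> that]) (use Suc.prems in auto)
    then show ?thesis by (rule differentiableI)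
  qed
  moreover have "k_smooth_on k S (\<lambda>x. frechet_derivative h (at x) v)" for v
    by (rule Suc.IH[of "\<lambda>x. frechet_derivative f (at x) v"]) (use e Suc.prems in auto)
  ultimately show ?case by simp
qed

text \<open>By uniqueness of derivatives, any explicit derivative may stand in for
  \<open>frechet_derivative\<close>. The closure proofs for sums, products and compositions all take
  their inductive step this way.\<close>

lemma k_smooth_on_SucI:
  assumes "open S" "\<And>x. x \<in> S \<Longrightarrow> (f has_derivative f' x) (at x)"
    and "\<And>v. k_smooth_on k S (\<lambda>x. f' x v)"
  shows "k_smooth_on (Suc k) S f"
proof -
  have "k_smooth_on k S (\<lambda>x. frechet_derivative f (at x) v)" for v
    by (rule k_smooth_on_cong[OF assms(1) _ assms(3)[of v]])
      (use assms(2) frechet_derivative_at in metis)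
  then show ?thesis using assms(2) by (auto intro: differentiableI)
qed

lemma k_smooth_on_Suc_has_derivative:
  assumes "k_smooth_on (Suc k) S f" "x \<in> S"
  shows "(f has_derivative frechet_derivative f (at x)) (at x)"
  using assms frechet_derivative_works by auto

lemma k_smooth_on_const: "k_smooth_on k S (\<lambda>x. c)"
  by (induction k arbitrary: c) auto

lemma k_smooth_on_add:
  assumes "open S" "k_smooth_on k S f" "k_smooth_on k S h"
  shows "k_smooth_on k S (\<lambda>x. f x + h x)"
  using assms(2,3)
proof (induction k arbitrary: f h)
  case 0 then show ?case by (auto intro: continuous_on_add)
next
  case (Suc k)
  show ?case
    by (rule k_smooth_on_SucI[OF \<open>open S\<close> has_derivative_add[OF
          k_smooth_on_Suc_has_derivative[OF Suc.prems(1)] k_smooth_on_Suc_has_derivative[OF Suc.prems(2)]]])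
      (use Suc in auto)
qed

lemma k_smooth_on_bounded_linear:
  assumes "open S" "bounded_linear h" "k_smooth_on k S f"
  shows "k_smooth_on k S (\<lambda>x. h (f x))"
  using assms(3)
proof (induction k arbitrary: f)
  case 0 then show ?case using assms(2) by (auto intro: bounded_linear.continuous_on)
next
  case (Suc k)
  show ?case
    by (rule k_smooth_on_SucI[OF \<open>open S\<close> bounded_linear.has_derivative[OF assms(2)
          k_smooth_on_Suc_has_derivative[OF Suc.prems]]])
      (use Suc in auto)
qed

lemma k_smooth_on_sum:
  assumes "open S" "\<And>i. i \<in> B \<Longrightarrow> k_smooth_on k S (f i)"
  shows "k_smooth_on k S (\<lambda>x. \<Sum>i\<in>B. f i x)"
  using assms(2)
  by (induction B rule: infinite_finite_induct)
    (auto intro: k_smooth_on_const k_smooth_on_add[OF assms(1)])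

lemma k_smooth_on_mult:
  fixes f h :: "'a::real_normed_vector \<Rightarrow> real"
  assumes "open S" "k_smooth_on k S f" "k_smooth_on k S h"
  shows "k_smooth_on k S (\<lambda>x. f x * h x)"
  using assms(2,3)
proof (induction k arbitrary: f h)
  case 0 then show ?case by (auto intro: continuous_on_mult)
next
  case (Suc k)
  \<comment> \<open>The product rule multiplies each derivative, of order \<open>k\<close>, by an
    undifferentiated factor, so the factors are lowered to order \<open>k\<close> before the
    induction hypothesis applies.\<close>
  have low: "k_smooth_on k S f" "k_smooth_on k S h"
    using Suc.prems k_smooth_on_SucD by blast+
  have "k_smooth_on k S (\<lambda>x. f x * frechet_derivative h (at x) v
      + frechet_derivative f (at x) v * h x)" for v
    by (intro k_smooth_on_add[OF \<open>open S\<close>] Suc.IH low) (use Suc.prems in auto)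
  then show ?case
    using k_smooth_on_SucI[OF \<open>open S\<close> has_derivative_mult[OF
          k_smooth_on_Suc_has_derivative[OF Suc.prems(1)] k_smooth_on_Suc_has_derivative[OF Suc.prems(2)]]]
    by blast
qed

lemma linear_sum_Basis:
  fixes x :: "'a::euclidean_space"
  assumes "linear h"
  shows "h x = (\<Sum>b\<in>Basis. (x \<bullet> b) *\<^sub>R h b)"
  by (metis (no_types, lifting) assms euclidean_representation linear_scale linear_sum sum.cong)

text \<open>In a basis the chain rule is a finite sum of products of scalar functions, so closure
  under sums and products carries the induction. The induction hypothesis is applied to the partial
  derivatives of \<open>f\<close>, which again are real-valued.\<close>

lemma k_smooth_on_compose:
  fixes f :: "'b::euclidean_space \<Rightarrow> real" and h :: "'a::real_normed_vector \<Rightarrow> 'b"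
  assumes "open S" "open T" "\<And>x. x \<in> S \<Longrightarrow> h x \<in> T" "k_smooth_on k T f" "k_smooth_on k S h"
  shows "k_smooth_on k S (\<lambda>x. f (h x))"
  using assms(4,5)
proof (induction k arbitrary: f)
  case 0 then show ?case using assms(3) by (auto intro: continuous_on_compose2)
next
  case (Suc k)
  define f' where "f' x v = (\<Sum>b\<in>Basis. (frechet_derivative h (at x) v \<bullet> b)
      * frechet_derivative f (at (h x)) b)" for x v
  show ?case
  proof (rule k_smooth_on_SucI[OF \<open>open S\<close>])
    fix x assume x: "x \<in> S"
    have 1: "(h has_derivative frechet_derivative h (at x)) (at x)"
      using k_smooth_on_Suc_has_derivative[OF Suc.prems(2) x] .
    have 2: "(f has_derivative frechet_derivative f (at (h x))) (at (h x))"
      using k_smooth_on_Suc_has_derivative[OF Suc.prems(1) assms(3)[OF x]] .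
    have "(frechet_derivative f (at (h x)) \<circ> frechet_derivative h (at x)) = f' x"
      unfolding f'_def o_def
      by (rule ext, subst linear_sum_Basis[OF has_derivative_linear[OF 2]]) simp
    then show "((\<lambda>x. f (h x)) has_derivative f' x) (at x)"
      using diff_chain_at[OF 1 2] by (simp add: o_def)
  next
    fix v
    have "k_smooth_on k S (\<lambda>x. frechet_derivative f (at (h x)) b)" for b
      by (rule Suc.IH[of "\<lambda>y. frechet_derivative f (at y) b"])
        (use Suc.prems k_smooth_on_SucD in auto)
    then show "k_smooth_on k S (\<lambda>x. f' x v)"
      unfolding f'_def
      by (intro k_smooth_on_sum k_smooth_on_mult \<open>open S\<close>
          k_smooth_on_bounded_linear[OF _ bounded_linear_inner_left]) (use Suc.prems in auto)
  qed
qed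

section \<open>Transfer of these properties to infinite order\<close>

lemma smooth_on_subset: "smooth_on S f \<Longrightarrow> T \<subseteq> S \<Longrightarrow> smooth_on T f"
  unfolding smooth_on_def using k_smooth_on_subset by blast

lemma smooth_on_cong:
  "open S \<Longrightarrow> (\<And>x. x \<in> S \<Longrightarrow> f x = h x) \<Longrightarrow> smooth_on S f \<Longrightarrow> smooth_on S h"
  unfolding smooth_on_def using k_smooth_on_cong by metis

lemma smooth_on_has_derivative:
  "smooth_on S f \<Longrightarrow> x \<in> S \<Longrightarrow> (f has_derivative frechet_derivative f (at x)) (at x)"
  unfolding smooth_on_def using k_smooth_on_Suc_has_derivative by blast

lemma smooth_on_continuous_on: "smooth_on S f \<Longrightarrow> continuous_on S f"
  unfolding smooth_on_def using k_smooth_on.simps(1) by blast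

lemma smooth_on_frechet_derivative:
  "smooth_on S f \<Longrightarrow> smooth_on S (\<lambda>x. frechet_derivative f (at x) v)"
  unfolding smooth_on_def using k_smooth_on.simps(2) by blast

lemma smooth_onI_has_derivative:
  assumes "open S" "\<And>x. x \<in> S \<Longrightarrow> (f has_derivative f' x) (at x)"
    and "\<And>v. smooth_on S (\<lambda>x. f' x v)"
  shows "smooth_on S f"
  unfolding smooth_on_def
proof
  fix k show "k_smooth_on k S f"
    \<comment> \<open>Order \<open>k + 1\<close> is proved and then lowered to \<open>k\<close>,
      which treats order 0 together with the others.\<close>
    by (rule k_smooth_on_SucD, rule k_smooth_on_SucI[OF assms(1,2)])
      (use assms(3) smooth_on_def in auto)
qed

lemma smooth_on_const: "smooth_on S (\<lambda>x. c)"
  by (simp add: smooth_on_def k_smooth_on_const)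

lemma smooth_on_add:
  "open S \<Longrightarrow> smooth_on S f \<Longrightarrow> smooth_on S h \<Longrightarrow> smooth_on S (\<lambda>x. f x + h x)"
  by (simp add: smooth_on_def k_smooth_on_add)

lemma smooth_on_bounded_linear:
  "open S \<Longrightarrow> bounded_linear h \<Longrightarrow> smooth_on S f \<Longrightarrow> smooth_on S (\<lambda>x. h (f x))"
  by (simp add: smooth_on_def k_smooth_on_bounded_linear)

lemma smooth_on_mult:
  fixes f h :: "'a::real_normed_vector \<Rightarrow> real"
  shows "open S \<Longrightarrow> smooth_on S f \<Longrightarrow> smooth_on S h \<Longrightarrow> smooth_on S (\<lambda>x. f x * h x)"
  by (simp add: smooth_on_def k_smooth_on_mult)

lemma smooth_on_compose:
  fixes f :: "'b::euclidean_space \<Rightarrow> real" and h :: "'a::real_normed_vector \<Rightarrow> 'b"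
  assumes "open S" "open T" "\<And>x. x \<in> S \<Longrightarrow> h x \<in> T" "smooth_on T f" "smooth_on S h"
  shows "smooth_on S (\<lambda>x. f (h x))"
  using assms unfolding smooth_on_def by (auto intro: k_smooth_on_compose)

section \<open>Symmetry of second derivatives and the Poincare lemma\<close>

text \<open>The mean value theorem is applied twice: along \<open>v\<close> to the difference of
  \<open>f\<close> across \<open>t w\<close>, then along \<open>w\<close> to the resulting
  derivative in direction \<open>v\<close>.\<close>

lemma second_difference_mvt:
  fixes f :: "'a::real_normed_vector \<Rightarrow> real"
  assumes f: "smooth_on S f" and "0 < t"
    and S: "\<And>\<sigma> \<tau>. 0 \<le> \<sigma> \<Longrightarrow> \<sigma> \<le> t \<Longrightarrow> 0 \<le> \<tau> \<Longrightarrow> \<tau> \<le> t \<Longrightarrow> x + \<sigma> *\<^sub>R v + \<tau> *\<^sub>R w \<in> S"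
  obtains \<sigma> \<tau> where "0 \<le> \<sigma>" "\<sigma> \<le> t" "0 \<le> \<tau>" "\<tau> \<le> t"
    "f (x + t *\<^sub>R v + t *\<^sub>R w) - f (x + t *\<^sub>R v) - f (x + t *\<^sub>R w) + f x
      = t * t * frechet_derivative (\<lambda>y. frechet_derivative f (at y) v) (at (x + \<sigma> *\<^sub>R v + \<tau> *\<^sub>R w)) w"
proof -
  let ?D = "\<lambda>y. frechet_derivative f (at y)"
  \<comment> \<open>The term \<open>0 *\<^sub>R w\<close> keeps both summands in the shape that
    \<open>line\<close> matches.\<close>
  define h where "h \<sigma> = f (x + \<sigma> *\<^sub>R v + t *\<^sub>R w) - f (x + \<sigma> *\<^sub>R v + 0 *\<^sub>R w)" for \<sigma>
  have line: "((\<lambda>\<sigma>. F (x + \<sigma> *\<^sub>R v + \<tau> *\<^sub>R w)) has_derivative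
      (\<lambda>s. s * F' v)) (at \<sigma>)"
    if "(F has_derivative F') (at (x + \<sigma> *\<^sub>R v + \<tau> *\<^sub>R w))"
    for F :: "'a \<Rightarrow> real" and F' \<sigma> \<tau>
  proof -
    have "((\<lambda>\<sigma>. x + \<sigma> *\<^sub>R v + \<tau> *\<^sub>R w) has_derivative (\<lambda>s. s *\<^sub>R v)) (at \<sigma>)"
      by (auto intro!: derivative_eq_intros)
    from diff_chain_at[OF this that] show ?thesis
      using linear_scale[OF has_derivative_linear[OF that]] by (simp add: o_def)
  qed
  have line': "((\<lambda>\<tau>. F (x + \<sigma> *\<^sub>R v + \<tau> *\<^sub>R w)) has_derivative
      (\<lambda>s. s * F' w)) (at \<tau>)"
    if "(F has_derivative F') (at (x + \<sigma> *\<^sub>R v + \<tau> *\<^sub>R w))"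
    for F :: "'a \<Rightarrow> real" and F' \<sigma> \<tau>
  proof -
    have "((\<lambda>\<tau>. x + \<sigma> *\<^sub>R v + \<tau> *\<^sub>R w) has_derivative (\<lambda>s. s *\<^sub>R w)) (at \<tau>)"
      by (auto intro!: derivative_eq_intros)
    from diff_chain_at[OF this that] show ?thesis
      using linear_scale[OF has_derivative_linear[OF that]] by (simp add: o_def)
  qed
  have "(h has_derivative (\<lambda>s. s * ?D (x + \<sigma> *\<^sub>R v + t *\<^sub>R w) v
      - s * ?D (x + \<sigma> *\<^sub>R v + 0 *\<^sub>R w) v)) (at \<sigma> within {0..t})" if "0 \<le> \<sigma>" "\<sigma> \<le> t" for \<sigma>
    unfolding h_def
    by (rule has_derivative_at_withinI, intro has_derivative_diff line smooth_on_has_derivative[OF f] S)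
      (use that \<open>0 < t\<close> in auto)
  from mvt_simple[OF \<open>0 < t\<close> this]
  obtain \<sigma> where \<sigma>: "0 < \<sigma>" "\<sigma> < t" and 1: "h t - h 0 = t * ?D (x + \<sigma> *\<^sub>R v + t *\<^sub>R w) v
      - t * ?D (x + \<sigma> *\<^sub>R v + 0 *\<^sub>R w) v"
    by auto
  have "((\<lambda>\<tau>. ?D (x + \<sigma> *\<^sub>R v + \<tau> *\<^sub>R w) v) has_derivative
      (\<lambda>s. s * frechet_derivative (\<lambda>y. ?D y v) (at (x + \<sigma> *\<^sub>R v + \<tau> *\<^sub>R w)) w)) (at \<tau> within {0..t})"
    if "0 \<le> \<tau>" "\<tau> \<le> t" for \<tau>
    by (rule has_derivative_at_withinI, rule line', rule smooth_on_has_derivative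
        [OF smooth_on_frechet_derivative[OF f]], rule S) (use that \<sigma> in auto)
  from mvt_simple[OF \<open>0 < t\<close> this]
  obtain \<tau> where \<tau>: "0 < \<tau>" "\<tau> < t" and 2: "?D (x + \<sigma> *\<^sub>R v + t *\<^sub>R w) v - ?D (x + \<sigma> *\<^sub>R v + 0 *\<^sub>R w) v
      = t * frechet_derivative (\<lambda>y. ?D y v) (at (x + \<sigma> *\<^sub>R v + \<tau> *\<^sub>R w)) w"
    by auto
  show ?thesis
  proof (rule that[of \<sigma> \<tau>])
    have "h t - h 0 = t * (?D (x + \<sigma> *\<^sub>R v + t *\<^sub>R w) v - ?D (x + \<sigma> *\<^sub>R v + 0 *\<^sub>R w) v)"
      unfolding 1 by (simp add: right_diff_distrib)
    then show "f (x + t *\<^sub>R v + t *\<^sub>R w) - f (x + t *\<^sub>R v) - f (x + t *\<^sub>R w) + f x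
      = t * t * frechet_derivative (\<lambda>y. ?D y v) (at (x + \<sigma> *\<^sub>R v + \<tau> *\<^sub>R w)) w"
      unfolding 2 by (simp add: h_def)
  qed (use \<sigma> \<tau> in auto)
qed

text \<open>The second difference of \<open>f\<close> is symmetric in \<open>v\<close> and
  \<open>w\<close>. Hence the two mixed derivatives take a common value at points arbitrarily close
  to \<open>x\<close>, and continuity makes them equal at \<open>x\<close>.\<close>

lemma frechet_derivative_commute:
  fixes f :: "'a::real_normed_vector \<Rightarrow> real"
  assumes f: "smooth_on S f" and "open S" "x \<in> S"
  shows "frechet_derivative (\<lambda>y. frechet_derivative f (at y) v) (at x) w
       = frechet_derivative (\<lambda>y. frechet_derivative f (at y) w) (at x) v" (is "?P x = ?Q x")
proof (rule ccontr)
  assume ne: "?P x \<noteq> ?Q x"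
  \<comment> \<open>Half the supposed gap: two approximations with error below \<open>e\<close>
    contradict it.\<close>
  define e where "e = \<bar>?P x - ?Q x\<bar> / 2"
  have "e > 0" using ne by (simp add: e_def)
  have cont: "continuous_on S ?P" "continuous_on S ?Q"
    by (intro smooth_on_continuous_on smooth_on_frechet_derivative f)+
  have "\<exists>d>0. \<forall>y. dist y x < d \<longrightarrow> y \<in> S \<and> dist (F y) (F x) < e"
    if "continuous_on S F" for F :: "'a \<Rightarrow> real"
  proof -
    have "\<forall>\<^sub>F y in nhds x. dist (F y) (F x) < e"
      using that \<open>open S\<close> \<open>x \<in> S\<close> \<open>e > 0\<close>
      by (simp add: continuous_on_eq_continuous_at isCont_def tendsto_at_iff_tendsto_nhds tendstoD)
    moreover have "\<forall>\<^sub>F y in nhds x. y \<in> S" using \<open>open S\<close> \<open>x \<in> S\<close> by (rule eventually_nhds_in_open)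
    ultimately have "\<forall>\<^sub>F y in nhds x. y \<in> S \<and> dist (F y) (F x) < e" by eventually_elim auto
    then show ?thesis by (simp add: eventually_nhds_metric)
  qed
  from this[OF cont(1)] this[OF cont(2)] obtain d1 d2 where
    d: "d1 > 0" "\<And>y. dist y x < d1 \<Longrightarrow> y \<in> S \<and> dist (?P y) (?P x) < e"
       "d2 > 0" "\<And>y. dist y x < d2 \<Longrightarrow> y \<in> S \<and> dist (?Q y) (?Q x) < e" by metis
  \<comment> \<open>The parallelogram with sides \<open>t v\<close> and \<open>t w\<close> then
    stays inside both radii. The summand 1 keeps the denominator positive when \<open>v\<close> and
    \<open>w\<close> vanish.\<close>
  define t where "t = min d1 d2 / (norm v + norm w + 1) / 2"
  have pos: "norm v + norm w + 1 > 0" by (simp add: add_nonneg_pos)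
  have t: "t > 0" using d(1,3) pos by (simp add: t_def)
  have near: "dist (x + \<sigma> *\<^sub>R v + \<tau> *\<^sub>R w) x < min d1 d2" if "0 \<le> \<sigma>" "\<sigma> \<le> t" "0 \<le> \<tau>" "\<tau> \<le> t" for \<sigma> \<tau>
  proof -
    have "dist (x + \<sigma> *\<^sub>R v + \<tau> *\<^sub>R w) x = norm (\<sigma> *\<^sub>R v + \<tau> *\<^sub>R w)"
      by (simp add: dist_norm algebra_simps)
    also have "\<dots> \<le> \<sigma> * norm v + \<tau> * norm w"
      using norm_triangle_ineq[of "\<sigma> *\<^sub>R v" "\<tau> *\<^sub>R w"] that by simp
    also have "\<dots> \<le> t * norm v + t * norm w"
      by (intro add_mono mult_right_mono that norm_ge_zero)
    also have "\<dots> \<le> t * (norm v + norm w + 1)" using t by (simp add: algebra_simps)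
    also have "\<dots> = min d1 d2 / 2" using pos unfolding t_def
      by (metis (no_types) less_numeral_extra(3) nonzero_divide_eq_eq times_divide_eq_left)
    also have "\<dots> < min d1 d2" using d by auto
    finally show ?thesis .
  qed
  obtain \<sigma> \<tau> where 1: "0 \<le> \<sigma>" "\<sigma> \<le> t" "0 \<le> \<tau>" "\<tau> \<le> t"
    "f (x + t *\<^sub>R v + t *\<^sub>R w) - f (x + t *\<^sub>R v) - f (x + t *\<^sub>R w) + f x
      = t * t * ?P (x + \<sigma> *\<^sub>R v + \<tau> *\<^sub>R w)"
    using second_difference_mvt[OF f t, of x v w] near d by (metis min_less_iff_conj)
  obtain \<sigma>' \<tau>' where 2: "0 \<le> \<sigma>'" "\<sigma>' \<le> t" "0 \<le> \<tau>'" "\<tau>' \<le> t"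
    "f (x + t *\<^sub>R w + t *\<^sub>R v) - f (x + t *\<^sub>R w) - f (x + t *\<^sub>R v) + f x
      = t * t * ?Q (x + \<sigma>' *\<^sub>R w + \<tau>' *\<^sub>R v)"
  proof (rule second_difference_mvt[OF f t, of x w v])
    fix \<sigma> \<tau> assume "0 \<le> \<sigma>" "\<sigma> \<le> t" "0 \<le> \<tau>" "\<tau> \<le> t"
    then show "x + \<sigma> *\<^sub>R w + \<tau> *\<^sub>R v \<in> S"
      using near[of \<tau> \<sigma>] d(2)[of "x + \<sigma> *\<^sub>R w + \<tau> *\<^sub>R v"] by (simp add: add.commute add.left_commute)
  qed blast
  have "t * t * ?P (x + \<sigma> *\<^sub>R v + \<tau> *\<^sub>R w) = t * t * ?Q (x + \<sigma>' *\<^sub>R w + \<tau>' *\<^sub>R v)"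
    unfolding 1(5)[symmetric] 2(5)[symmetric] by (simp add: add.commute add.left_commute)
  then have "?P (x + \<sigma> *\<^sub>R v + \<tau> *\<^sub>R w) = ?Q (x + \<sigma>' *\<^sub>R w + \<tau>' *\<^sub>R v)" using t by simp
  moreover have "dist (?P (x + \<sigma> *\<^sub>R v + \<tau> *\<^sub>R w)) (?P x) < e" using near[of \<sigma> \<tau>] 1 d by auto
  moreover have "dist (?Q (x + \<sigma>' *\<^sub>R w + \<tau>' *\<^sub>R v)) (?Q x) < e"
    using near[of \<tau>' \<sigma>'] 2 d(4)[of "x + \<sigma>' *\<^sub>R w + \<tau>' *\<^sub>R v"] by (simp add: add.commute add.left_commute)
  ultimately have "\<bar>?P x - ?Q x\<bar> < 2 * e" unfolding dist_real_def by linarith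
  then show False by (simp add: e_def)
qed


section \<open>The Poincare lemma for 1-forms on convex open sets\<close>

text \<open>The primitive is the integral of the form along the segments from \<open>c\<close>, that
  is, of \<open>a (c + t (x - c)) (x - c)\<close> over \<open>t\<close> from 0 to 1. It is
  differentiated under the integral sign; closedness turns the differentiated integrand into an
  exact \<open>t\<close>-derivative.\<close>

lemma poincare_1form:
  fixes a :: "'e::euclidean_space \<Rightarrow> 'e \<Rightarrow> real"
  assumes "open S" "convex S" "c \<in> S"
    and lin: "\<And>x. x \<in> S \<Longrightarrow> linear (a x)"
    and sm: "\<And>v. smooth_on S (\<lambda>x. a x v)"
    and closed: "\<And>x v w. x \<in> S \<Longrightarrow> frechet_derivative (\<lambda>y. a y v) (at x) w
      = frechet_derivative (\<lambda>y. a y w) (at x) v"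
  obtains m where "\<And>x. x \<in> S \<Longrightarrow> (m has_derivative a x) (at x)"
proof -
  define D where "D v y = frechet_derivative (\<lambda>y. a y v) (at y)" for v y
  define \<gamma> where "\<gamma> x t = c + t *\<^sub>R (x - c)" for x and t :: real
  \<comment> \<open>The partial derivative, in the basis direction \<open>b\<close>, of the
    integrand \<open>f x t\<close> with respect to \<open>x\<close>.\<close>
  define G where "G b x t = t * (\<Sum>k\<in>Basis. D k (\<gamma> x t) b * ((x - c) \<bullet> k)) + a (\<gamma> x t) b" for b x t
  define f where "f x t = (\<Sum>k\<in>Basis. a (\<gamma> x t) k * ((x - c) \<bullet> k))" for x t
  \<comment> \<open>The partial derivatives are packed into a bounded linear function, the form in
    which \<open>leibniz_rule\<close> takes the derivative of the integrand.\<close>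
  define fx where "fx x t = (\<Sum>b\<in>Basis. G b x t *\<^sub>R blinfun_inner_right b)" for x t
  have \<gamma>_in: "\<gamma> x t \<in> S" if "x \<in> S" "t \<in> {0..1}" for x t
  proof -
    have "\<gamma> x t = (1 - t) *\<^sub>R c + t *\<^sub>R x" by (simp add: \<gamma>_def algebra_simps)
    then show ?thesis using that \<open>convex S\<close> \<open>c \<in> S\<close> by (auto simp: convex_alt)
  qed
  have D: "((\<lambda>y. a y v) has_derivative D v y) (at y)" if "y \<in> S" for v y
    unfolding D_def by (rule smooth_on_has_derivative[OF sm that])
  have a_sum: "a y v = (\<Sum>b\<in>Basis. (v \<bullet> b) * a y b)" if "y \<in> S" for y v
    using linear_sum_Basis[OF lin[OF that], of v] by simp
  have D_sum: "D u y v = (\<Sum>b\<in>Basis. (v \<bullet> b) * D u y b)" if "y \<in> S" for u y v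
    using linear_sum_Basis[OF has_derivative_linear[OF D[OF that]], of u v] by simp
  have fx_apply: "blinfun_apply (fx x t) v
      = t * (\<Sum>k\<in>Basis. D k (\<gamma> x t) v * ((x - c) \<bullet> k)) + a (\<gamma> x t) v"
    if "x \<in> S" "t \<in> {0..1}" for x t v
  proof -
    have "blinfun_apply (fx x t) v = (\<Sum>b\<in>Basis. G b x t * (v \<bullet> b))"
      by (simp add: fx_def blinfun.sum_left blinfun.scaleR_left inner_commute)
    also have "\<dots> = t * (\<Sum>b\<in>Basis. \<Sum>k\<in>Basis. (v \<bullet> b) * D k (\<gamma> x t) b * ((x - c) \<bullet> k))
        + (\<Sum>b\<in>Basis. (v \<bullet> b) * a (\<gamma> x t) b)"
      by (simp add: G_def distrib_right sum.distrib sum_distrib_left sum_distrib_right algebra_simps)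
    also have "(\<Sum>b\<in>Basis. \<Sum>k\<in>Basis. (v \<bullet> b) * D k (\<gamma> x t) b * ((x - c) \<bullet> k))
        = (\<Sum>k\<in>Basis. D k (\<gamma> x t) v * ((x - c) \<bullet> k))"
      by (subst sum.swap) (simp only: D_sum[OF \<gamma>_in[OF that], of _ v] sum_distrib_right)
    also have "(\<Sum>b\<in>Basis. (v \<bullet> b) * a (\<gamma> x t) b) = a (\<gamma> x t) v"
      by (rule a_sum[OF \<gamma>_in[OF that], symmetric])
    finally show ?thesis .
  qed
  have deriv_f: "((\<lambda>x. f x t) has_derivative blinfun_apply (fx x t)) (at x within S)"
    if "x \<in> S" "t \<in> cbox 0 1" for x t
  proof -
    have t: "t \<in> {0..1}" using that(2) by simp
    have \<gamma>': "((\<lambda>x. \<gamma> x t) has_derivative (\<lambda>v. t *\<^sub>R v)) (at x)"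
      unfolding \<gamma>_def by (auto intro!: derivative_eq_intros)
    have "((\<lambda>x. a (\<gamma> x t) k) has_derivative (\<lambda>v. t * D k (\<gamma> x t) v)) (at x)" for k
      using diff_chain_at[OF \<gamma>' D[OF \<gamma>_in[OF that(1) t]]]
        linear_scale[OF has_derivative_linear[OF D[OF \<gamma>_in[OF that(1) t]]]]
      by (simp add: o_def)
    then have "((\<lambda>x. a (\<gamma> x t) k * ((x - c) \<bullet> k)) has_derivative
        (\<lambda>v. a (\<gamma> x t) k * (v \<bullet> k) + t * D k (\<gamma> x t) v * ((x - c) \<bullet> k))) (at x)" for k
      by (rule has_derivative_mult) (auto intro!: derivative_eq_intros)
    then have "((\<lambda>x. f x t) has_derivative
        (\<lambda>v. \<Sum>k\<in>Basis. a (\<gamma> x t) k * (v \<bullet> k) + t * D k (\<gamma> x t) v * ((x - c) \<bullet> k))) (at x)"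
      unfolding f_def by (intro has_derivative_sum)
    moreover have "(\<Sum>k\<in>Basis. a (\<gamma> x t) k * (v \<bullet> k) + t * D k (\<gamma> x t) v * ((x - c) \<bullet> k))
        = blinfun_apply (fx x t) v" for v
      unfolding fx_apply[OF that(1) t] a_sum[OF \<gamma>_in[OF that(1) t], of v]
      by (simp add: sum.distrib sum_distrib_left mult_ac add_ac)
    ultimately show ?thesis by (simp add: has_derivative_at_withinI)
  qed
  have \<gamma>_cont: "continuous_on (S \<times> {0..1}) (\<lambda>(x, t). \<gamma> x t)"
    unfolding \<gamma>_def split_beta by (intro continuous_intros)
  have comp: "continuous_on (S \<times> {0..1}) (\<lambda>(x, t). F (\<gamma> x t))"
    if "continuous_on S F" for F :: "'e \<Rightarrow> real"
    using continuous_on_compose2[OF that \<gamma>_cont] \<gamma>_in by (force simp: split_beta)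
  have fx_cont: "continuous_on (S \<times> cbox 0 1) (\<lambda>(x, t). fx x t)"
  proof -
    have "continuous_on (S \<times> {0..1}) (\<lambda>(x, t). D k (\<gamma> x t) b)" for k b
      unfolding D_def by (intro comp smooth_on_continuous_on smooth_on_frechet_derivative sm)
    moreover have "continuous_on (S \<times> {0..1}) (\<lambda>(x, t). a (\<gamma> x t) b)" for b
      by (intro comp smooth_on_continuous_on sm)
    ultimately show ?thesis
      unfolding fx_def G_def split_beta cbox_interval by (intro continuous_intros)
  qed
  have pair: "continuous_on I (\<lambda>t. (x, t))" for I :: "real set" and x :: 'e
    by (intro continuous_on_Pair continuous_on_const continuous_on_id)
  have f_int: "f x integrable_on cbox 0 1" if "x \<in> S" for x
  proof -
    have "continuous_on {0..1} (\<lambda>t. a (\<gamma> x t) k)" for k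
      using continuous_on_compose2[OF comp[OF smooth_on_continuous_on[OF sm[of k]]] pair[of _ x]] that
      by auto
    then have "continuous_on {0..1} (f x)" unfolding f_def by (intro continuous_intros)
    then show ?thesis using integrable_continuous_interval by auto
  qed
  have fx_int: "fx x integrable_on cbox 0 1" if "x \<in> S" for x
  proof -
    have "continuous_on (cbox 0 1) (fx x)"
      using continuous_on_compose2[OF fx_cont pair[of _ x]] that by auto
    then show ?thesis by (rule integrable_continuous)
  qed
  have val: "blinfun_apply (integral (cbox 0 1) (fx x)) v = a x v" if x: "x \<in> S" for x v
  proof -
    \<comment> \<open>The integrand is the \<open>t\<close>-derivative of
      \<open>t * a (\<gamma> x t) v\<close>, which vanishes at 0 and equals \<open>a x v\<close> at
      1.\<close>
    have "((\<lambda>t. blinfun_apply (fx x t) v) has_integral (1 * a (\<gamma> x 1) v - 0 * a (\<gamma> x 0) v)) {0..1}"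
    proof (rule fundamental_theorem_of_calculus)
      fix t :: real assume t: "t \<in> {0..1}"
      have \<gamma>': "((\<lambda>t. \<gamma> x t) has_derivative (\<lambda>s. s *\<^sub>R (x - c))) (at t)"
        unfolding \<gamma>_def by (auto intro!: derivative_eq_intros)
      have "((\<lambda>t. a (\<gamma> x t) v) has_derivative (\<lambda>s. s * D v (\<gamma> x t) (x - c))) (at t)"
        using diff_chain_at[OF \<gamma>' D[OF \<gamma>_in[OF x t]]]
          linear_scale[OF has_derivative_linear[OF D[OF \<gamma>_in[OF x t]]]]
        by (simp add: o_def)
      then have "((\<lambda>t. t * a (\<gamma> x t) v) has_derivative
          (\<lambda>s. t * (s * D v (\<gamma> x t) (x - c)) + s * a (\<gamma> x t) v)) (at t)"
        by (rule has_derivative_mult[OF has_derivative_ident])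
      moreover have "t * (s * D v (\<gamma> x t) (x - c)) + s * a (\<gamma> x t) v
          = s * blinfun_apply (fx x t) v" for s
      proof -
        \<comment> \<open>Closedness enters here: it exchanges the direction \<open>v\<close> with
          the basis vector \<open>k\<close>.\<close>
        have "(\<Sum>k\<in>Basis. D k (\<gamma> x t) v * ((x - c) \<bullet> k)) = D v (\<gamma> x t) (x - c)"
          unfolding D_sum[OF \<gamma>_in[OF x t], of v "x - c"] using closed[OF \<gamma>_in[OF x t]]
          by (simp add: D_def mult.commute)
        then show ?thesis by (simp add: fx_apply[OF x t] algebra_simps)
      qed
      ultimately show "((\<lambda>t. t * a (\<gamma> x t) v) has_vector_derivative blinfun_apply (fx x t) v)
          (at t within {0..1})"
        by (simp add: has_vector_derivative_def has_derivative_at_withinI)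
    qed simp
    moreover have "\<gamma> x 1 = x" by (simp add: \<gamma>_def)
    ultimately have "integral {0..1} (\<lambda>t. blinfun_apply (fx x t) v) = a x v"
      by (simp add: integral_unique)
    then show ?thesis using blinfun_apply_integral[OF fx_int[OF x]] by simp
  qed
  show ?thesis
  proof (rule that[of "\<lambda>x. integral (cbox 0 1) (f x)"])
    fix x assume x: "x \<in> S"
    have "((\<lambda>x. integral (cbox 0 1) (f x)) has_derivative integral (cbox 0 1) (fx x)) (at x within S)"
      by (rule leibniz_rule[OF deriv_f f_int fx_cont x \<open>convex S\<close>])
    moreover have "blinfun_apply (integral (cbox 0 1) (fx x)) = a x" using val[OF x] by auto
    ultimately show "((\<lambda>x. integral (cbox 0 1) (f x)) has_derivative a x) (at x)"
      using at_within_open[OF x \<open>open S\<close>] by simp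
  qed
qed


section \<open>Charts and tangent vectors\<close>

locale manifold =
  fixes A :: "('m::{t2_space, second_countable_topology}, 'e::euclidean_space) chart set"
  assumes atlas: "smooth_atlas A"
begin

section \<open>Charts as homeomorphisms\<close>

lemma chart_at: obtains W \<phi> where "(W, \<phi>) \<in> A" "p \<in> W"
proof -
  have "p \<in> (\<Union>(W, \<phi>)\<in>A. W)" using atlas by (simp add: smooth_atlas_def)
  then show ?thesis using that by auto
qed

context
  fixes W \<phi> assumes chart: "(W, \<phi>) \<in> A"
begin

lemma chart_homeomorphism: "homeomorphism W (\<phi> ` W) \<phi> (inv_into W \<phi>)"
  and open_chart_domain: "open W"
  and open_chart_image: "open (\<phi> ` W)"
  using atlas chart unfolding smooth_atlas_def by auto

lemma chart_inv: "q \<in> W \<Longrightarrow> inv_into W \<phi> (\<phi> q) = q"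
  by (rule homeomorphism_apply1[OF chart_homeomorphism])

lemma chart_inv_in: "x \<in> \<phi> ` (W \<inter> V) \<Longrightarrow> inv_into W \<phi> x \<in> W \<inter> V"
  using chart_inv by auto

lemma chart_inv_right: "x \<in> \<phi> ` W \<Longrightarrow> \<phi> (inv_into W \<phi> x) = x"
  by (rule f_inv_into_f)

lemma open_chart_image_Int: "open V \<Longrightarrow> open (\<phi> ` (W \<inter> V))"
  using homeomorphism_imp_open_map[OF chart_homeomorphism, of "W \<inter> V"] open_chart_domain open_chart_image
  by (metis Int_lower1 open_Int openin_open_eq openin_open_trans)

lemma open_chart_preimage:
  assumes "open B" shows "open {q \<in> W. \<phi> q \<in> B}"
proof -
  have "continuous_on W \<phi>" using chart_homeomorphism homeomorphism_cont1 by blast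
  then have "open (W \<inter> \<phi> -` B)"
    using open_chart_domain assms by (simp add: continuous_on_open_vimage Int_commute)
  then show ?thesis by (simp add: Int_def vimage_def)
qed

end

lemma transition_smooth:
  "(W, \<phi>) \<in> A \<Longrightarrow> (W', \<psi>) \<in> A \<Longrightarrow> smooth_on (\<phi> ` (W \<inter> W')) (\<psi> \<circ> inv_into W \<phi>)"
  using atlas unfolding smooth_atlas_def by auto

section \<open>Smooth functions on the manifold and near a point\<close>

lemma smooth_fun_chart:
  "f \<in> smooth_funs A U \<Longrightarrow> (W, \<phi>) \<in> A \<Longrightarrow> smooth_on (\<phi> ` (W \<inter> U)) (f \<circ> inv_into W \<phi>)"
  unfolding smooth_funs_def by auto

lemma smooth_funsI:
  "(\<And>W \<phi>. (W, \<phi>) \<in> A \<Longrightarrow> smooth_on (\<phi> ` (W \<inter> U)) (\<lambda>x. f (inv_into W \<phi> x))) \<Longrightarrow> f \<in> smooth_funs A U"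
  unfolding smooth_funs_def o_def by auto

lemma smooth_funs_mono: "f \<in> smooth_funs A U \<Longrightarrow> V \<subseteq> U \<Longrightarrow> f \<in> smooth_funs A V"
  by (rule smooth_funsI, rule smooth_on_subset[OF smooth_fun_chart[unfolded o_def]]) auto

lemma smooth_funs_cong:
  assumes "open U" "\<And>q. q \<in> U \<Longrightarrow> f q = h q" "f \<in> smooth_funs A U"
  shows "h \<in> smooth_funs A U"
proof (rule smooth_funsI)
  fix W \<phi> assume c: "(W, \<phi>) \<in> A"
  show "smooth_on (\<phi> ` (W \<inter> U)) (\<lambda>x. h (inv_into W \<phi> x))"
    by (rule smooth_on_cong[OF open_chart_image_Int[OF c \<open>open U\<close>] _ smooth_fun_chart[OF assms(3) c]])
      (use chart_inv_in[OF c] assms(2) in auto)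
qed

lemma smooth_funs_const: "(\<lambda>q. k) \<in> smooth_funs A U"
  by (intro smooth_funsI smooth_on_const)

lemma smooth_funs_add:
  "open U \<Longrightarrow> f \<in> smooth_funs A U \<Longrightarrow> h \<in> smooth_funs A U \<Longrightarrow> (\<lambda>q. f q + h q) \<in> smooth_funs A U"
  by (intro smooth_funsI smooth_on_add open_chart_image_Int) (auto dest: smooth_fun_chart simp: o_def)

lemma smooth_funs_mult:
  "open U \<Longrightarrow> f \<in> smooth_funs A U \<Longrightarrow> h \<in> smooth_funs A U \<Longrightarrow> (\<lambda>q. f q * h q) \<in> smooth_funs A U"
  by (intro smooth_funsI smooth_on_mult open_chart_image_Int) (auto dest: smooth_fun_chart simp: o_def)

lemma smooth_funs_diff:
  assumes "open U" "f \<in> smooth_funs A U" "h \<in> smooth_funs A U"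
  shows "(\<lambda>q. f q - h q) \<in> smooth_funs A U"
  using smooth_funs_add[OF assms(1,2) smooth_funs_mult[OF assms(1) smooth_funs_const[of "- 1"] assms(3)]]
  by simp

lemma smooth_funs_chart_coordinate:
  assumes "(W, \<phi>) \<in> A" shows "(\<lambda>q. \<phi> q \<bullet> b) \<in> smooth_funs A W"
  by (intro smooth_funsI smooth_on_bounded_linear[OF _ bounded_linear_inner_left] open_chart_image_Int
      open_chart_domain[OF assms] transition_smooth[OF _ assms, unfolded o_def])

text \<open>Smoothness must be tested in every chart of the atlas; in another chart the function is
  \<open>F\<close> after a transition map.\<close>

lemma smooth_funs_pullback:
  assumes c: "(W, \<phi>) \<in> A" and "open U" "U \<subseteq> W" and F: "smooth_on (\<phi> ` U) F"
  shows "(\<lambda>q. F (\<phi> q)) \<in> smooth_funs A U"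
proof (rule smooth_funsI)
  fix W' \<psi> assume c': "(W', \<psi>) \<in> A"
  show "smooth_on (\<psi> ` (W' \<inter> U)) (\<lambda>x. F (\<phi> (inv_into W' \<psi> x)))"
  proof (rule smooth_on_compose[OF _ _ _ F])
    show "open (\<phi> ` U)"
      using open_chart_image_Int[OF c \<open>open U\<close>] \<open>U \<subseteq> W\<close> by (simp add: Int_absorb1)
    show "smooth_on (\<psi> ` (W' \<inter> U)) (\<lambda>x. \<phi> (inv_into W' \<psi> x))"
      by (rule smooth_on_subset[OF transition_smooth[OF c' c, unfolded o_def]]) (use \<open>U \<subseteq> W\<close> in auto)
  qed (use open_chart_image_Int[OF c' \<open>open U\<close>] chart_inv_in[OF c'] in auto)
qed

lemma smooth_nearI: "open U \<Longrightarrow> p \<in> U \<Longrightarrow> f \<in> smooth_funs A U \<Longrightarrow> smooth_near A p f"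
  unfolding smooth_near_def by auto

lemma smooth_near_cong:
  assumes "open U" "p \<in> U" "\<And>q. q \<in> U \<Longrightarrow> f q = h q" "smooth_near A p f"
  shows "smooth_near A p h"
proof -
  obtain V where V: "open V" "p \<in> V" "f \<in> smooth_funs A V" using assms(4) smooth_near_def by blast
  then have "f \<in> smooth_funs A (U \<inter> V)" by (auto intro: smooth_funs_mono)
  then have "h \<in> smooth_funs A (U \<inter> V)" using smooth_funs_cong[of "U \<inter> V" f h] assms V by auto
  then show ?thesis using V assms by (intro smooth_nearI[of "U \<inter> V"]) auto
qed

lemma smooth_near_has_derivative:
  assumes "smooth_near A p f" and c: "(W, \<phi>) \<in> A" and "p \<in> W"
  shows "((\<lambda>x. f (inv_into W \<phi> x)) has_derivative
      frechet_derivative (\<lambda>x. f (inv_into W \<phi> x)) (at (\<phi> p))) (at (\<phi> p))"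
proof -
  obtain V where V: "open V" "p \<in> V" "f \<in> smooth_funs A V" using assms(1) smooth_near_def by blast
  show ?thesis
    by (rule smooth_on_has_derivative[OF smooth_fun_chart[OF V(3) c, unfolded o_def]]) (use V assms in auto)
qed

section \<open>Tangent vectors as derivations\<close>

lemma coord_tvec_eq:
  assumes "smooth_near A p f" and c: "(W, \<phi>) \<in> A" and "p \<in> W"
    and "((\<lambda>x. f (inv_into W \<phi> x)) has_derivative f') (at (\<phi> p))"
  shows "coord_tvec A (W, \<phi>) p w f = f' w"
  using assms frechet_derivative_at[OF assms(4)] by (simp add: coord_tvec_def o_def)

lemma coord_tvec_in: "(W, \<phi>) \<in> A \<Longrightarrow> p \<in> W \<Longrightarrow> coord_tvec A (W, \<phi>) p w \<in> tangent_space A p"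
  unfolding tangent_space_def by force

text \<open>By the chain rule, components change by the derivative of the transition map. Every
  tangent vector can thus be written in whichever chart is at hand, and the later pointwise
  arguments need just one chart.\<close>

lemma tangent_space_chart_change:
  assumes u: "u \<in> tangent_space A p" and c: "(W, \<phi>) \<in> A" and p: "p \<in> W"
  obtains w where "u = coord_tvec A (W, \<phi>) p w"
proof -
  obtain W' \<psi> w' where c': "(W', \<psi>) \<in> A" "p \<in> W'" and u': "u = coord_tvec A (W', \<psi>) p w'"
    using u unfolding tangent_space_def by auto
  let ?\<tau> = "\<lambda>x. \<phi> (inv_into W' \<psi> x)"
  define T' where "T' = frechet_derivative ?\<tau> (at (\<psi> p))"
  have T': "(?\<tau> has_derivative T') (at (\<psi> p))"
    unfolding T'_def
    by (rule smooth_on_has_derivative[OF transition_smooth[OF c'(1) c, unfolded o_def]]) (use c' p in auto)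
  have \<tau>p: "?\<tau> (\<psi> p) = \<phi> p" using chart_inv[OF c'(1)] c'(2) by simp
  have "u f = coord_tvec A (W, \<phi>) p (T' w') f" for f
  proof (cases "smooth_near A p f")
    case True
    let ?f' = "frechet_derivative (\<lambda>x. f (inv_into W \<phi> x)) (at (\<phi> p))"
    have f': "((\<lambda>x. f (inv_into W \<phi> x)) has_derivative ?f') (at (\<phi> p))"
      by (rule smooth_near_has_derivative[OF True c p])
    have "((\<lambda>x. f (inv_into W \<phi> (?\<tau> x))) has_derivative (\<lambda>v. ?f' (T' v))) (at (\<psi> p))"
      using diff_chain_at[OF T'] f' unfolding \<tau>p o_def by blast
    then have "((\<lambda>x. f (inv_into W' \<psi> x)) has_derivative (\<lambda>v. ?f' (T' v))) (at (\<psi> p))"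
    proof (rule has_derivative_transform_within_open)
      show "open (\<psi> ` (W' \<inter> W))" using open_chart_image_Int[OF c'(1) open_chart_domain[OF c]] .
      show "f (inv_into W \<phi> (?\<tau> x)) = f (inv_into W' \<psi> x)" if "x \<in> \<psi> ` (W' \<inter> W)" for x
        using chart_inv[OF c] chart_inv_in[OF c'(1) that] by simp
    qed (use c' p in auto)
    then show ?thesis
      unfolding u' coord_tvec_eq[OF True c'] coord_tvec_eq[OF True c p f']
      using coord_tvec_eq[OF True c'] by simp
  next
    \<comment> \<open>Both sides are 0 by the convention for functions that are not smooth near
      \<open>p\<close>.\<close>
    case False
    then show ?thesis by (simp add: u' coord_tvec_def)
  qed
  then show ?thesis using that by blast
qed

lemma tvec_not_smooth: "u \<in> tangent_space A p \<Longrightarrow> \<not> smooth_near A p f \<Longrightarrow> u f = 0"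
  unfolding tangent_space_def coord_tvec_def by auto

text \<open>A tangent vector sees only germs: derivatives are local, and so is smoothness near
  \<open>p\<close>, so the default value 0 is taken at both functions or at neither.\<close>

lemma tvec_cong:
  assumes u: "u \<in> tangent_space A p" and U: "open U" "p \<in> U" "\<And>q. q \<in> U \<Longrightarrow> f q = h q"
  shows "u f = u h"
proof (cases "smooth_near A p f")
  case True
  then have sh: "smooth_near A p h" using smooth_near_cong U by blast
  obtain W \<phi> where c: "(W, \<phi>) \<in> A" "p \<in> W" by (rule chart_at)
  obtain w where w: "u = coord_tvec A (W, \<phi>) p w" using tangent_space_chart_change[OF u c] .
  note f' = smooth_near_has_derivative[OF True c]
  have "((\<lambda>x. h (inv_into W \<phi> x)) has_derivative
      frechet_derivative (\<lambda>x. f (inv_into W \<phi> x)) (at (\<phi> p))) (at (\<phi> p))"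
    by (rule has_derivative_transform_within_open[OF f' open_chart_image_Int[OF c(1) U(1)]])
      (use c U chart_inv_in[OF c(1)] in auto)
  then show ?thesis unfolding w using coord_tvec_eq[OF True c f'] coord_tvec_eq[OF sh c] by simp
next
  case False
  then have "\<not> smooth_near A p h" using smooth_near_cong[OF U(1,2), of h f] U(3) by auto
  then show ?thesis using False tvec_not_smooth[OF u] by simp
qed

lemma smooth_near_common:
  assumes "smooth_near A p f" "smooth_near A p h"
  obtains U where "open U" "p \<in> U" "f \<in> smooth_funs A U" "h \<in> smooth_funs A U"
proof -
  obtain U V where "open U" "p \<in> U" "f \<in> smooth_funs A U" "open V" "p \<in> V" "h \<in> smooth_funs A V"
    using assms unfolding smooth_near_def by blast
  then show ?thesis using that[of "U \<inter> V"] by (auto intro: smooth_funs_mono)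
qed

lemma smooth_near_add: "smooth_near A p f \<Longrightarrow> smooth_near A p h \<Longrightarrow> smooth_near A p (\<lambda>q. f q + h q)"
  by (erule (1) smooth_near_common) (rule smooth_nearI, assumption, assumption, rule smooth_funs_add)

lemma smooth_near_mult: "smooth_near A p f \<Longrightarrow> smooth_near A p h \<Longrightarrow> smooth_near A p (\<lambda>q. f q * h q)"
  by (erule (1) smooth_near_common) (rule smooth_nearI, assumption, assumption, rule smooth_funs_mult)

lemma smooth_near_const: "smooth_near A p (\<lambda>q. k)"
  using smooth_nearI[of UNIV] smooth_funs_const by blast

lemma tvec_add:
  assumes u: "u \<in> tangent_space A p" and f: "smooth_near A p f" and h: "smooth_near A p h"
  shows "u (\<lambda>q. f q + h q) = u f + u h"
proof -
  obtain W \<phi> where c: "(W, \<phi>) \<in> A" "p \<in> W" by (rule chart_at)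
  obtain w where w: "u = coord_tvec A (W, \<phi>) p w" using tangent_space_chart_change[OF u c] .
  note f' = smooth_near_has_derivative[OF f c] and h' = smooth_near_has_derivative[OF h c]
  show ?thesis
    unfolding w coord_tvec_eq[OF f c f'] coord_tvec_eq[OF h c h']
      coord_tvec_eq[OF smooth_near_add[OF f h] c has_derivative_add[OF f' h']] ..
qed

lemma tvec_mult:
  assumes u: "u \<in> tangent_space A p" and f: "smooth_near A p f" and h: "smooth_near A p h"
  shows "u (\<lambda>q. f q * h q) = f p * u h + u f * h p"
proof -
  obtain W \<phi> where c: "(W, \<phi>) \<in> A" "p \<in> W" by (rule chart_at)
  obtain w where w: "u = coord_tvec A (W, \<phi>) p w" using tangent_space_chart_change[OF u c] .
  note f' = smooth_near_has_derivative[OF f c] and h' = smooth_near_has_derivative[OF h c]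
  show ?thesis
    unfolding w coord_tvec_eq[OF f c f'] coord_tvec_eq[OF h c h']
      coord_tvec_eq[OF smooth_near_mult[OF f h] c has_derivative_mult[OF f' h']] chart_inv[OF c] ..
qed

lemma tvec_const:
  assumes u: "u \<in> tangent_space A p" shows "u (\<lambda>q. k) = 0"
proof -
  obtain W \<phi> where c: "(W, \<phi>) \<in> A" "p \<in> W" by (rule chart_at)
  obtain w where w: "u = coord_tvec A (W, \<phi>) p w" using tangent_space_chart_change[OF u c] .
  show ?thesis unfolding w coord_tvec_eq[OF smooth_near_const c has_derivative_const] ..
qed

lemma tvec_cmult: "u \<in> tangent_space A p \<Longrightarrow> smooth_near A p f \<Longrightarrow> u (\<lambda>q. k * f q) = k * u f"
  using tvec_mult[OF _ smooth_near_const, of u p f k] by (simp add: tvec_const)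

lemma smooth_near_sum:
  "(\<And>i. i \<in> B \<Longrightarrow> smooth_near A p (f i)) \<Longrightarrow> smooth_near A p (\<lambda>q. \<Sum>i\<in>B. f i q)"
  by (induction B rule: infinite_finite_induct) (auto intro: smooth_near_add smooth_near_const)

lemma tvec_sum:
  assumes u: "u \<in> tangent_space A p" and "\<And>i. i \<in> B \<Longrightarrow> smooth_near A p (f i)"
  shows "u (\<lambda>q. \<Sum>i\<in>B. f i q) = (\<Sum>i\<in>B. u (f i))"
  using assms(2)
  by (induction B rule: infinite_finite_induct)
    (auto simp: tvec_const[OF u] tvec_add[OF u] smooth_near_sum)

lemma coord_tvec_lincomb:
  assumes c: "(W, \<phi>) \<in> A" "p \<in> W"
  shows "coord_tvec A (W, \<phi>) p (a *\<^sub>R x + b *\<^sub>R y)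
    = (\<lambda>f. a * coord_tvec A (W, \<phi>) p x f + b * coord_tvec A (W, \<phi>) p y f)"
proof
  fix f
  show "coord_tvec A (W, \<phi>) p (a *\<^sub>R x + b *\<^sub>R y) f
      = a * coord_tvec A (W, \<phi>) p x f + b * coord_tvec A (W, \<phi>) p y f"
  proof (cases "smooth_near A p f")
    case True
    note f' = smooth_near_has_derivative[OF True c]
    show ?thesis unfolding coord_tvec_eq[OF True c f']
      using has_derivative_linear[OF f'] by (simp add: linear_add linear_scale)
  qed (simp add: coord_tvec_def)
qed

lemma tangent_space_lincomb:
  assumes u: "u \<in> tangent_space A p" and v: "v \<in> tangent_space A p"
  shows "(\<lambda>f. a * u f + b * v f) \<in> tangent_space A p"
proof -
  obtain W \<phi> where c: "(W, \<phi>) \<in> A" "p \<in> W" by (rule chart_at)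
  obtain x where x: "u = coord_tvec A (W, \<phi>) p x" using tangent_space_chart_change[OF u c] .
  obtain y where y: "v = coord_tvec A (W, \<phi>) p y" using tangent_space_chart_change[OF v c] .
  show ?thesis
    unfolding x y coord_tvec_lincomb[OF c, symmetric] by (rule coord_tvec_in[OF c])
qed

lemma tangent_space_diff:
  "u \<in> tangent_space A p \<Longrightarrow> v \<in> tangent_space A p \<Longrightarrow> (\<lambda>f. u f - v f) \<in> tangent_space A p"
  using tangent_space_lincomb[of u p v 1 "- 1"] by simp

lemma tangent_space_zero: "(\<lambda>f. 0) \<in> tangent_space A p"
proof -
  obtain W \<phi> where c: "(W, \<phi>) \<in> A" "p \<in> W" by (rule chart_at)
  show ?thesis using tangent_space_lincomb[OF coord_tvec_in[OF c] coord_tvec_in[OF c], of 0 undefined 0]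
    by simp
qed

text \<open>The components of a tangent vector are its values on the coordinate functions, because
  these are linear in the chart.\<close>

lemma tvec_expand:
  assumes u: "u \<in> tangent_space A p" and c: "(W, \<phi>) \<in> A" and p: "p \<in> W"
  shows "u = coord_tvec A (W, \<phi>) p (\<Sum>b\<in>Basis. u (\<lambda>q. \<phi> q \<bullet> b) *\<^sub>R b)"
proof -
  obtain w where w: "u = coord_tvec A (W, \<phi>) p w" using tangent_space_chart_change[OF u c p] .
  have "u (\<lambda>q. \<phi> q \<bullet> b) = w \<bullet> b" for b
    unfolding w
  proof (rule coord_tvec_eq[OF _ c p])
    show "smooth_near A p (\<lambda>q. \<phi> q \<bullet> b)"
      using smooth_nearI open_chart_domain[OF c] p smooth_funs_chart_coordinate[OF c] by blast
    show "((\<lambda>x. \<phi> (inv_into W \<phi> x) \<bullet> b) has_derivative (\<lambda>v. v \<bullet> b)) (at (\<phi> p))"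
      by (rule has_derivative_transform_within_open[OF _ open_chart_image[OF c], of "\<lambda>x. x \<bullet> b"])
        (use p chart_inv_right[OF c] in \<open>auto intro!: derivative_eq_intros\<close>)
  qed
  then show ?thesis using w by (simp add: euclidean_representation)
qed

lemma coord_tvec_sum:
  assumes c: "(W, \<phi>) \<in> A" and p: "p \<in> W"
  shows "coord_tvec A (W, \<phi>) p (\<Sum>b\<in>Basis. w b *\<^sub>R b) f = (\<Sum>b\<in>Basis. w b * coord_tvec A (W, \<phi>) p b f)"
proof (cases "smooth_near A p f")
  case True
  note f' = smooth_near_has_derivative[OF True c p]
  show ?thesis unfolding coord_tvec_eq[OF True c p f']
    using has_derivative_linear[OF f'] by (simp add: linear_sum linear_scale)
qed (simp add: coord_tvec_def)

lemma tvec_expand_sum: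
  assumes "u \<in> tangent_space A p" "(W, \<phi>) \<in> A" "p \<in> W"
  shows "u f = (\<Sum>b\<in>Basis. u (\<lambda>q. \<phi> q \<bullet> b) * coord_tvec A (W, \<phi>) p b f)"
  by (subst tvec_expand[OF assms]) (rule coord_tvec_sum[OF assms(2,3)])

section \<open>Coordinate vector fields and the Lie bracket\<close>

lemma vfields_tangent: "X \<in> vfields A U \<Longrightarrow> p \<in> U \<Longrightarrow> X p \<in> tangent_space A p"
  unfolding vfields_def by auto

lemma vfields_smooth:
  "X \<in> vfields A U \<Longrightarrow> open W \<Longrightarrow> W \<subseteq> U \<Longrightarrow> f \<in> smooth_funs A W \<Longrightarrow> (\<lambda>p. X p f) \<in> smooth_funs A W"
  unfolding vfields_def by auto

lemma vfields_mono: "X \<in> vfields A U \<Longrightarrow> W \<subseteq> U \<Longrightarrow> X \<in> vfields A W"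
  unfolding vfields_def mem_Collect_eq by (meson subset_trans subsetD)

lemma smooth_near_vfield:
  assumes X: "X \<in> vfields A U" and "open U" "p \<in> U" and "smooth_near A p f"
  shows "smooth_near A p (\<lambda>q. X q f)"
proof -
  obtain V where V: "open V" "p \<in> V" "f \<in> smooth_funs A V" using assms(4) smooth_near_def by blast
  have "(\<lambda>q. X q f) \<in> smooth_funs A (U \<inter> V)"
    by (rule vfields_smooth[OF X _ _ smooth_funs_mono[OF V(3)]]) (use V assms(2) in auto)
  then show ?thesis using V assms(2,3) by (intro smooth_nearI[of "U \<inter> V"]) auto
qed

lemma coord_vfield_apply:
  assumes f: "f \<in> smooth_funs A U" and "open U" "q \<in> U" and c: "(W, \<phi>) \<in> A" "q \<in> W"
  shows "coord_tvec A (W, \<phi>) q v f = frechet_derivative (\<lambda>x. f (inv_into W \<phi> x)) (at (\<phi> q)) v"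
  by (rule coord_tvec_eq[OF smooth_nearI[OF assms(2,3,1)] c smooth_near_has_derivative[OF smooth_nearI[OF assms(2,3,1)] c]])

lemma coord_vfield:
  assumes c: "(W, \<phi>) \<in> A"
  shows "(\<lambda>q. coord_tvec A (W, \<phi>) q v) \<in> vfields A W"
  unfolding vfields_def
proof (intro CollectI conjI ballI allI impI)
  fix U f assume U: "open U" "U \<subseteq> W" and f: "f \<in> smooth_funs A U"
  have "smooth_on (\<phi> ` U) (\<lambda>x. f (inv_into W \<phi> x))"
    using smooth_fun_chart[OF f c] U by (simp add: o_def Int_absorb1)
  then have "(\<lambda>q. frechet_derivative (\<lambda>x. f (inv_into W \<phi> x)) (at (\<phi> q)) v) \<in> smooth_funs A U"
    using smooth_funs_pullback[OF c U smooth_on_frechet_derivative] by blast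
  then show "(\<lambda>q. coord_tvec A (W, \<phi>) q v f) \<in> smooth_funs A U"
    by (rule smooth_funs_cong[OF U(1), rotated]) (use coord_vfield_apply[OF f U(1) _ c] U in auto)
qed (rule coord_tvec_in[OF c])

text \<open>Read in the chart, this is the symmetry of second derivatives.\<close>

lemma coord_vfields_commute:
  assumes c: "(W, \<phi>) \<in> A" "p \<in> W" and "smooth_near A p f"
  shows "coord_tvec A (W, \<phi>) p v (\<lambda>q. coord_tvec A (W, \<phi>) q w f)
       = coord_tvec A (W, \<phi>) p w (\<lambda>q. coord_tvec A (W, \<phi>) q v f)"
proof -
  obtain V where V: "open V" "p \<in> V" "f \<in> smooth_funs A V" using assms(3) smooth_near_def by blast
  have op: "open (\<phi> ` (W \<inter> V))" by (rule open_chart_image_Int[OF c(1) V(1)])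
  have sm: "smooth_on (\<phi> ` (W \<inter> V)) (\<lambda>x. f (inv_into W \<phi> x))"
    using smooth_fun_chart[OF V(3) c(1)] by (simp add: o_def)
  have "coord_tvec A (W, \<phi>) p v (\<lambda>q. coord_tvec A (W, \<phi>) q w f)
      = frechet_derivative (\<lambda>y. frechet_derivative (\<lambda>x. f (inv_into W \<phi> x)) (at y) w) (at (\<phi> p)) v" for v w
  proof (rule coord_tvec_eq[OF _ c])
    show "smooth_near A p (\<lambda>q. coord_tvec A (W, \<phi>) q w f)"
      by (rule smooth_near_vfield[OF coord_vfield[OF c(1)] open_chart_domain[OF c(1)] c(2) assms(3)])
    show "((\<lambda>x. coord_tvec A (W, \<phi>) (inv_into W \<phi> x) w f) has_derivative
        frechet_derivative (\<lambda>y. frechet_derivative (\<lambda>x. f (inv_into W \<phi> x)) (at y) w) (at (\<phi> p))) (at (\<phi> p))"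
    proof (rule has_derivative_transform_within_open[OF smooth_on_has_derivative[OF smooth_on_frechet_derivative[OF sm]] op])
      fix x assume x: "x \<in> \<phi> ` (W \<inter> V)"
      show "frechet_derivative (\<lambda>x. f (inv_into W \<phi> x)) (at x) w = coord_tvec A (W, \<phi>) (inv_into W \<phi> x) w f"
        using coord_vfield_apply[OF V(3,1) _ c(1), of "inv_into W \<phi> x" w] chart_inv_in[OF c(1) x]
          chart_inv_right[OF c(1), of x] x by auto
    qed (use c V in auto)
  qed
  then show ?thesis using frechet_derivative_commute[OF sm op, of "\<phi> p" w v] c V by auto
qed

text \<open>The bracket is a commutator of derivations, while \<open>tangent_space\<close> contains
  only first-order coordinate derivatives. Expansion in the coordinate frame shows that the
  second-order terms cancel and reveals the components of the bracket.\<close>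

lemma lie_bracket_tangent:
  assumes X: "X \<in> vfields A U" and Y: "Y \<in> vfields A U" and U: "open U" "p \<in> U"
  shows "lie_bracket A X Y p \<in> tangent_space A p"
proof -
  obtain W \<phi> where c: "(W, \<phi>) \<in> A" "p \<in> W" by (rule chart_at)
  let ?E = "\<lambda>b q. coord_tvec A (W, \<phi>) q b"
  let ?x = "\<lambda>b q. \<phi> q \<bullet> b"
  have x: "smooth_near A p (?x b)" for b
    using smooth_nearI[OF open_chart_domain[OF c(1)] c(2)] smooth_funs_chart_coordinate[OF c(1)] by blast
  have E: "smooth_near A p f \<Longrightarrow> smooth_near A p (\<lambda>q. ?E b q f)" for b f
    by (rule smooth_near_vfield[OF coord_vfield[OF c(1)] open_chart_domain[OF c(1)] c(2)])
  \<comment> \<open>The product rule splits the iterated derivative into a first-order sum and a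
    double sum holding the second derivatives of \<open>f\<close>.\<close>
  have iter: "X p (\<lambda>q. Y q f) = (\<Sum>b\<in>Basis. X p (\<lambda>q. Y q (?x b)) * ?E b p f)
      + (\<Sum>b\<in>Basis. \<Sum>a\<in>Basis. Y p (?x b) * X p (?x a) * ?E a p (\<lambda>q. ?E b q f))"
    if X: "X \<in> vfields A U" and Y: "Y \<in> vfields A U" and f: "smooth_near A p f" for X Y f
  proof -
    have Xp: "X p \<in> tangent_space A p" by (rule vfields_tangent[OF X U(2)])
    have yx: "smooth_near A p (\<lambda>q. Y q (?x b))" for b by (rule smooth_near_vfield[OF Y U x])
    have XE: "X p (\<lambda>q. ?E b q f) = (\<Sum>a\<in>Basis. X p (?x a) * ?E a p (\<lambda>q. ?E b q f))" for b
      by (rule tvec_expand_sum[OF Xp c])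
    have "X p (\<lambda>q. Y q f) = X p (\<lambda>q. \<Sum>b\<in>Basis. Y q (?x b) * ?E b q f)"
    proof (rule tvec_cong[OF Xp])
      show "open (U \<inter> W)" using U open_chart_domain[OF c(1)] by blast
      show "Y q f = (\<Sum>b\<in>Basis. Y q (?x b) * ?E b q f)" if "q \<in> U \<inter> W" for q
        using tvec_expand_sum[OF vfields_tangent[OF Y] c(1)] that by blast
    qed (use U c in blast)
    also have "\<dots> = (\<Sum>b\<in>Basis. X p (\<lambda>q. Y q (?x b) * ?E b q f))"
      by (rule tvec_sum[OF Xp]) (intro smooth_near_mult yx E f)
    also have "\<dots> = (\<Sum>b\<in>Basis. Y p (?x b) * X p (\<lambda>q. ?E b q f) + X p (\<lambda>q. Y q (?x b)) * ?E b p f)"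
      by (intro sum.cong refl tvec_mult[OF Xp yx E[OF f]])
    also have "\<dots> = (\<Sum>b\<in>Basis. X p (\<lambda>q. Y q (?x b)) * ?E b p f)
      + (\<Sum>b\<in>Basis. \<Sum>a\<in>Basis. Y p (?x b) * X p (?x a) * ?E a p (\<lambda>q. ?E b q f))"
      by (simp add: XE sum.distrib sum_distrib_left mult.assoc)
    finally show ?thesis .
  qed
  have "lie_bracket A X Y p f
      = coord_tvec A (W, \<phi>) p (\<Sum>b\<in>Basis. (X p (\<lambda>q. Y q (?x b)) - Y p (\<lambda>q. X q (?x b))) *\<^sub>R b) f" for f
  proof (cases "smooth_near A p f")
    case True
    \<comment> \<open>The second-order part is symmetric in \<open>X\<close> and \<open>Y\<close>,
      so it drops out of the commutator.\<close>
    have "(\<Sum>b\<in>Basis. \<Sum>a\<in>Basis. Y p (?x b) * X p (?x a) * ?E a p (\<lambda>q. ?E b q f))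
        = (\<Sum>b\<in>Basis. \<Sum>a\<in>Basis. X p (?x b) * Y p (?x a) * ?E a p (\<lambda>q. ?E b q f))"
      by (subst sum.swap, intro sum.cong refl, subst coord_vfields_commute[OF c True]) simp
    then have "lie_bracket A X Y p f
        = (\<Sum>b\<in>Basis. (X p (\<lambda>q. Y q (?x b)) - Y p (\<lambda>q. X q (?x b))) * ?E b p f)"
      using True by (simp add: lie_bracket_def iter[OF X Y True] iter[OF Y X True]
          left_diff_distrib sum_subtractf)
    then show ?thesis by (simp add: coord_tvec_sum[OF c])
  qed (simp add: lie_bracket_def coord_tvec_def)
  then have "lie_bracket A X Y p
      = coord_tvec A (W, \<phi>) p (\<Sum>b\<in>Basis. (X p (\<lambda>q. Y q (?x b)) - Y p (\<lambda>q. X q (?x b))) *\<^sub>R b)" by blast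
  then show ?thesis using coord_tvec_in[OF c] by simp
qed

lemma lie_bracket_vfield:
  assumes X: "X \<in> vfields A U" and Y: "Y \<in> vfields A U" and U: "open U"
  shows "lie_bracket A X Y \<in> vfields A U"
  unfolding vfields_def
proof (intro CollectI conjI ballI allI impI)
  fix W f assume W: "open W" "W \<subseteq> U" and f: "f \<in> smooth_funs A W"
  have "(\<lambda>p. X p (\<lambda>q. Y q f) - Y p (\<lambda>q. X q f)) \<in> smooth_funs A W"
    by (intro smooth_funs_diff W vfields_smooth[OF X] vfields_smooth[OF Y] f)
  then show "(\<lambda>p. lie_bracket A X Y p f) \<in> smooth_funs A W"
    by (rule smooth_funs_cong[OF W(1), rotated]) (simp add: lie_bracket_def smooth_nearI[OF W(1) _ f])
qed (rule lie_bracket_tangent[OF X Y U])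

lemma lie_bracket_coord_vfields:
  assumes "(W, \<phi>) \<in> A" "p \<in> W"
  shows "lie_bracket A (\<lambda>q. coord_tvec A (W, \<phi>) q v) (\<lambda>q. coord_tvec A (W, \<phi>) q w) p = (\<lambda>f. 0)"
  using coord_vfields_commute[OF assms] by (simp add: lie_bracket_def fun_eq_iff)

end


section \<open>HKT structures\<close>

locale hkt =
  fixes A :: "('m::{t2_space, second_countable_topology}, 'e::euclidean_space) chart set"
    and g :: "'m metric" and I :: "nat \<Rightarrow> 'm endo" and D :: "'m connection"
  assumes hyperhermitian: "hyperhermitian A g I" and connection: "hkt_connection A g I D"

sublocale hkt \<subseteq> manifold A
  using hyperhermitian by unfold_locales (simp add: hyperhermitian_def)

context hkt
begin

section \<open>Pointwise algebra of the metric and the complex structures\<close>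

lemma metric: "riemannian_metric A g"
  and endo: "r \<in> {1,2,3} \<Longrightarrow> endo_field A (I r)"
  using hyperhermitian
  by (auto simp: hyperhermitian_def hypercomplex_structure_def integrable_complex_structure_def)

lemma g_sym: "u \<in> tangent_space A p \<Longrightarrow> v \<in> tangent_space A p \<Longrightarrow> g p u v = g p v u"
  using metric unfolding riemannian_metric_def by meson

lemma g_lincomb_left:
  "u \<in> tangent_space A p \<Longrightarrow> v \<in> tangent_space A p \<Longrightarrow> w \<in> tangent_space A p
    \<Longrightarrow> g p (\<lambda>f. a * u f + b * v f) w = a * g p u w + b * g p v w"
  using metric unfolding riemannian_metric_def by meson

lemma g_lincomb_right:
  "u \<in> tangent_space A p \<Longrightarrow> v \<in> tangent_space A p \<Longrightarrow> w \<in> tangent_space A p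
    \<Longrightarrow> g p w (\<lambda>f. a * u f + b * v f) = a * g p w u + b * g p w v"
  using g_lincomb_left[of u p v w a b] g_sym[of u p w] g_sym[of v p w]
    g_sym[OF tangent_space_lincomb[of u p v a b], of w] by simp

lemma g_diff_left:
  "u \<in> tangent_space A p \<Longrightarrow> v \<in> tangent_space A p \<Longrightarrow> w \<in> tangent_space A p
    \<Longrightarrow> g p (\<lambda>f. u f - v f) w = g p u w - g p v w"
  using g_lincomb_left[of u p v w 1 "- 1"] by simp

lemma g_uminus_left:
  "u \<in> tangent_space A p \<Longrightarrow> w \<in> tangent_space A p \<Longrightarrow> g p (\<lambda>f. - u f) w = - g p u w"
  using g_lincomb_left[of u p u w "- 1" 0] by simp

lemma g_zero_left: "w \<in> tangent_space A p \<Longrightarrow> g p (\<lambda>f. 0) w = 0"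
  using g_lincomb_left[of w p w w 0 0] by simp

lemma g_definite: "u \<in> tangent_space A p \<Longrightarrow> g p u u = 0 \<Longrightarrow> u = (\<lambda>f. 0)"
  using metric unfolding riemannian_metric_def by (metis less_irrefl)

lemma g_smooth:
  "open U \<Longrightarrow> X \<in> vfields A U \<Longrightarrow> Y \<in> vfields A U \<Longrightarrow> (\<lambda>p. g p (X p) (Y p)) \<in> smooth_funs A U"
  using metric unfolding riemannian_metric_def by meson

lemma I_tangent: "r \<in> {1,2,3} \<Longrightarrow> u \<in> tangent_space A p \<Longrightarrow> I r p u \<in> tangent_space A p"
  using endo unfolding endo_field_def by meson

lemma I_lincomb:
  "r \<in> {1,2,3} \<Longrightarrow> u \<in> tangent_space A p \<Longrightarrow> v \<in> tangent_space A p
    \<Longrightarrow> I r p (\<lambda>f. a * u f + b * v f) = (\<lambda>f. a * I r p u f + b * I r p v f)"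
  using endo unfolding endo_field_def by meson

lemma I_uminus:
  "r \<in> {1,2,3} \<Longrightarrow> u \<in> tangent_space A p \<Longrightarrow> I r p (\<lambda>f. - u f) = (\<lambda>f. - I r p u f)"
  using I_lincomb[of r u p u "- 1" 0] by simp

lemma I_zero: "r \<in> {1,2,3} \<Longrightarrow> I r p (\<lambda>f. 0) = (\<lambda>f. 0)"
  using I_lincomb[OF _ tangent_space_zero tangent_space_zero, of r p 0 0] by simp

lemma I_vfield: "r \<in> {1,2,3} \<Longrightarrow> open U \<Longrightarrow> X \<in> vfields A U \<Longrightarrow> apply_endo (I r) X \<in> vfields A U"
  using endo unfolding endo_field_def by meson

lemma I_square: "r \<in> {1,2,3} \<Longrightarrow> u \<in> tangent_space A p \<Longrightarrow> I r p (I r p u) = (\<lambda>f. - u f)"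
  using hyperhermitian
  unfolding hyperhermitian_def hypercomplex_structure_def integrable_complex_structure_def by meson

text \<open>The definition provides only the products of \<open>I 1\<close> and \<open>I 2\<close>;
  the other two cyclic products follow from \<open>I 3 = - I 2 I 1\<close> and the squares being
  minus the identity.\<close>

lemma I_cyclic:
  assumes rst: "(r, s, t) \<in> {(1,2,3), (2,3,1), (3,1,2)}" and u: "u \<in> tangent_space A p"
  shows "I r p (I s p u) = I t p u"
proof -
  have q: "I 1 p (I 2 p v) = I 3 p v" "I 3 p v = (\<lambda>f. - I 2 p (I 1 p v) f)"
    if "v \<in> tangent_space A p" for v
    using hyperhermitian that unfolding hyperhermitian_def hypercomplex_structure_def by meson+
  note T = I_tangent[OF _ u] I_tangent[OF _ I_tangent[OF _ u]]
  have "I 2 p (I 3 p u) = (\<lambda>f. - I 2 p (I 2 p (I 1 p u)) f)"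
    using I_uminus[of 2 "I 2 p (I 1 p u)" p] T q(2)[OF u] by simp
  also have "\<dots> = I 1 p u" using I_square[of 2 "I 1 p u" p] T by simp
  finally have 23: "I 2 p (I 3 p u) = I 1 p u" .
  have "I 3 p (I 1 p u) = (\<lambda>f. - I 2 p (I 1 p (I 1 p u)) f)" using q(2) T by simp
  also have "\<dots> = I 2 p u" using I_square[of 1 u p] I_uminus[of 2 u p] u by simp
  finally show ?thesis using rst 23 q(1)[OF u] by auto
qed

lemma g_I: "r \<in> {1,2,3} \<Longrightarrow> u \<in> tangent_space A p \<Longrightarrow> v \<in> tangent_space A p
    \<Longrightarrow> g p (I r p u) (I r p v) = g p u v"
  using hyperhermitian unfolding hyperhermitian_def by meson

text \<open>An isometry whose square is minus the identity is skew-adjoint.\<close>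

lemma g_I_left:
  assumes "r \<in> {1,2,3}" "u \<in> tangent_space A p" "v \<in> tangent_space A p"
  shows "g p (I r p u) v = - g p u (I r p v)"
proof -
  have "g p (I r p u) v = g p (I r p (I r p u)) (I r p v)" using g_I[OF assms(1) I_tangent[OF assms(1,2)] assms(3)] by simp
  also have "\<dots> = - g p u (I r p v)" using assms by (simp add: I_square g_uminus_left I_tangent)
  finally show ?thesis .
qed

section \<open>Covariant calculus over a fixed open set\<close>

context
  fixes U :: "'m set" assumes U: "open U"
begin

lemma D_vfield: "X \<in> vfields A U \<Longrightarrow> Y \<in> vfields A U \<Longrightarrow> D X Y \<in> vfields A U"
  using connection U smooth_funs_const unfolding hkt_connection_def linear_connection_def by meson

lemma D_metric:
  "X \<in> vfields A U \<Longrightarrow> Y \<in> vfields A U \<Longrightarrow> Z \<in> vfields A U \<Longrightarrow> p \<in> U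
    \<Longrightarrow> X p (\<lambda>q. g q (Y q) (Z q)) = g p (D X Y p) (Z p) + g p (Y p) (D X Z p)"
proof -
  assume "X \<in> vfields A U" "Y \<in> vfields A U" "Z \<in> vfields A U" "p \<in> U"
  moreover have "parallel_metric A D g" using connection by (simp add: hkt_connection_def)
  ultimately have "X p (\<lambda>q. g q (Y q) (Z q)) - g p (D X Y p) (Z p) - g p (Y p) (D X Z p) = 0"
    using U unfolding parallel_metric_def by meson
  then show ?thesis by simp
qed

lemma D_endo:
  assumes "r \<in> {1,2,3}" "X \<in> vfields A U" "Y \<in> vfields A U" "p \<in> U"
  shows "D X (apply_endo (I r) Y) p = I r p (D X Y p)"
proof -
  have "parallel_endo A D (I r)" using connection assms(1) unfolding hkt_connection_def by meson
  then have "(\<lambda>f. D X (apply_endo (I r) Y) p f - I r p (D X Y p) f) = (\<lambda>f. 0)"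
    using U assms unfolding parallel_endo_def by meson
  then show ?thesis by (simp add: fun_eq_iff)
qed

lemma torsion_tangent:
  "X \<in> vfields A U \<Longrightarrow> Y \<in> vfields A U \<Longrightarrow> p \<in> U \<Longrightarrow> torsion A D X Y p \<in> tangent_space A p"
  unfolding torsion_def
  by (intro tangent_space_diff vfields_tangent[OF D_vfield] lie_bracket_tangent[OF _ _ U])

lemma torsion_3form_alternating:
  assumes "X \<in> vfields A U" "Y \<in> vfields A U" "Z \<in> vfields A U" "p \<in> U"
  shows "torsion_3form A g D Y X Z p = - torsion_3form A g D X Y Z p"
    and "torsion_3form A g D X Z Y p = - torsion_3form A g D X Y Z p"
proof -
  have "torsion_3form A g D X Y Z p = - torsion_3form A g D Y X Z p \<and>
      torsion_3form A g D X Y Z p = - torsion_3form A g D X Z Y p"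
    using connection U assms unfolding hkt_connection_def by meson
  then show "torsion_3form A g D Y X Z p = - torsion_3form A g D X Y Z p"
    "torsion_3form A g D X Z Y p = - torsion_3form A g D X Y Z p" by auto
qed

text \<open>The definition of torsion, solved for the bracket and paired with \<open>Z\<close>. It
  serves to trade Lie brackets for covariant derivatives and the torsion 3-form.\<close>

lemma g_lie_bracket:
  assumes "X \<in> vfields A U" "Y \<in> vfields A U" "Z \<in> vfields A U" "p \<in> U"
  shows "g p (lie_bracket A X Y p) (Z p)
    = g p (D X Y p) (Z p) - g p (D Y X p) (Z p) - torsion_3form A g D X Y Z p"
proof -
  have "lie_bracket A X Y p = (\<lambda>f. (D X Y p f - D Y X p f) - torsion A D X Y p f)"
    by (simp add: torsion_def)
  moreover note T = vfields_tangent[OF D_vfield[OF assms(1,2)] assms(4)]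
    vfields_tangent[OF D_vfield[OF assms(2,1)] assms(4)]
    torsion_tangent[OF assms(1,2,4)] vfields_tangent[OF assms(3,4)]
  ultimately show ?thesis
    using g_diff_left[OF tangent_space_diff[OF T(1,2)] T(3,4)] g_diff_left[OF T(1,2,4)]
    by (simp add: torsion_3form_def)
qed

text \<open>In the Lie derivative of \<open>g\<close> along \<open>K\<close>, the derivatives along
  \<open>K\<close> cancel because \<open>g\<close> is parallel, and the two torsion terms cancel
  because the torsion form is alternating. What remains is the symmetric part of the derivative of
  \<open>K\<close>.\<close>

lemma killing_skew:
  assumes K: "killing A g K" "K \<in> vfields A U" and X: "X \<in> vfields A U" and Y: "Y \<in> vfields A U"
    and p: "p \<in> U"
  shows "g p (D X K p) (Y p) = - g p (D Y K p) (X p)"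
proof -
  have "lie_metric A K g X Y p = 0" using K U X Y p unfolding killing_def by meson
  moreover have "g p (X p) (D K Y p) = g p (D K Y p) (X p)"
    "g p (X p) (lie_bracket A K Y p) = g p (lie_bracket A K Y p) (X p)"
    by (intro g_sym vfields_tangent[OF X p] vfields_tangent[OF D_vfield[OF K(2) Y] p]
        vfields_tangent[OF lie_bracket_vfield[OF K(2) Y U] p])+
  ultimately show ?thesis
    unfolding lie_metric_def D_metric[OF K(2) X Y p]
    using g_lie_bracket[OF K(2) X Y p] g_lie_bracket[OF K(2) Y X p]
      torsion_3form_alternating(2)[OF K(2) X Y p] by simp
qed

text \<open>By metric compatibility the covariant derivatives of \<open>X\<close> and
  \<open>Y\<close> cancel against those in the bracket, leaving those of \<open>K\<close> and one
  torsion term.\<close>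

lemma ext_d1_dual_form:
  assumes K: "K \<in> vfields A U" and X: "X \<in> vfields A U" and Y: "Y \<in> vfields A U" and p: "p \<in> U"
  shows "ext_d1 A (dual_form g K) X Y p
    = g p (D X K p) (Y p) - g p (D Y K p) (X p) + torsion_3form A g D X Y K p"
proof -
  have sym: "g p (K p) (Z p) = g p (Z p) (K p)" if "Z \<in> vfields A U" for Z
    by (intro g_sym vfields_tangent[OF K p] vfields_tangent[OF that p])
  have "ext_d1 A (dual_form g K) X Y p = X p (\<lambda>q. g q (K q) (Y q)) - Y p (\<lambda>q. g q (K q) (X q))
      - g p (K p) (lie_bracket A X Y p)"
    by (simp add: ext_d1_def dual_form_def[abs_def])
  then show ?thesis
    unfolding D_metric[OF X K Y p] D_metric[OF Y K X p] sym[OF lie_bracket_vfield[OF X Y U]]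
      g_lie_bracket[OF X Y K p] sym[OF D_vfield[OF X Y]] sym[OF D_vfield[OF Y X]]
    by simp
qed

text \<open>Forms are functions on globally defined fields and may differ away from
  \<open>U\<close>; agreement over \<open>U\<close> suffices because tangent vectors at
  \<open>p\<close> depend only on germs.\<close>

lemma ext_d1_cong:
  assumes X: "X \<in> vfields A U" and Y: "Y \<in> vfields A U" and p: "p \<in> U"
    and eq: "\<And>Z q. Z \<in> vfields A U \<Longrightarrow> q \<in> U \<Longrightarrow> \<alpha> Z q = \<beta> Z q"
  shows "ext_d1 A \<alpha> X Y p = ext_d1 A \<beta> X Y p"
  unfolding ext_d1_def
  using tvec_cong[OF vfields_tangent[OF X p] U p, of "\<alpha> Y" "\<beta> Y"] tvec_cong[OF vfields_tangent[OF Y p] U p, of "\<alpha> X" "\<beta> X"]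
    eq[OF X] eq[OF Y] eq[OF lie_bracket_vfield[OF X Y U] p] by simp

lemma ext_d1_cmult_dual_form:
  assumes K: "K \<in> vfields A U" and X: "X \<in> vfields A U" and Y: "Y \<in> vfields A U" and p: "p \<in> U"
  shows "ext_d1 A (\<lambda>Z q. k * dual_form g K Z q) X Y p = k * ext_d1 A (dual_form g K) X Y p"
proof -
  have "smooth_near A p (dual_form g K Z)" if "Z \<in> vfields A U" for Z
    using smooth_nearI[OF U p g_smooth[OF U K that]] by (simp add: dual_form_def[abs_def])
  then show ?thesis
    unfolding ext_d1_def
    using tvec_cmult[OF vfields_tangent[OF X p], of "dual_form g K Y" k]
      tvec_cmult[OF vfields_tangent[OF Y p], of "dual_form g K X" k] X Y
    by (simp add: algebra_simps)
qed

end

end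

section \<open>Symmetries and potentials\<close>

locale hkt_symmetry = hkt A g I D for A :: "('m::{t2_space, second_countable_topology}, 'e::euclidean_space) chart set"
    and g and I and D +
  fixes V :: "'m vfield"
  assumes symmetry: "D21_symmetry A g I V"
begin

section \<open>Parallelism of the symmetry field\<close>

lemma V_vfield: "V \<in> vfields A U"
  by (rule vfields_mono[OF symmetry[unfolded D21_symmetry_def, THEN conjunct1] subset_UNIV])

lemma killing_V: "killing A g V"
  and killing_IV: "r \<in> {1,2,3} \<Longrightarrow> killing A g (apply_endo (I r) V)"
  using symmetry unfolding D21_symmetry_def by meson+

lemma dual_form_closed:
  "open U \<Longrightarrow> X \<in> vfields A U \<Longrightarrow> Y \<in> vfields A U \<Longrightarrow> p \<in> U \<Longrightarrow> ext_d1 A (dual_form g V) X Y p = 0"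
  using symmetry unfolding D21_symmetry_def form2_eq_on_def by (meson subset_UNIV)

context
  fixes U :: "'m set" assumes U: "open U"
begin

lemma IV_vfield: "r \<in> {1,2,3} \<Longrightarrow> apply_endo (I r) V \<in> vfields A U"
  by (rule I_vfield[OF _ U V_vfield])

text \<open>As \<open>I r\<close> is parallel and skew-adjoint, it can be moved from the
  differentiated field to the other argument of \<open>g\<close>. Killing skewness is used once for
  \<open>I r V\<close> and once for \<open>V\<close>, and the two factors \<open>I r\<close> that
  meet in between give a sign.\<close>

lemma DV_I_skew:
  assumes r: "r \<in> {1,2,3}" and X: "X \<in> vfields A U" and Y: "Y \<in> vfields A U" and p: "p \<in> U"
  shows "g p (D (apply_endo (I r) X) V p) (I r p (Y p)) = - g p (D X V p) (Y p)"
proof -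
  note T = vfields_tangent[OF _ p] D_vfield[OF U _ V_vfield]
  have B: "g p (D Z (apply_endo (I r) V) p) (W p) = - g p (D Z V p) (I r p (W p))"
    if "Z \<in> vfields A U" "W \<in> vfields A U" for Z W
    using that T by (simp add: D_endo[OF U r _ V_vfield p] g_I_left[OF r])
  note IX = I_vfield[OF r U X] and IY = I_vfield[OF r U Y]
  have "g p (D (apply_endo (I r) X) V p) (I r p (Y p))
      = - g p (D (apply_endo (I r) X) (apply_endo (I r) V) p) (Y p)"
    using B[OF IX Y] by simp
  also have "\<dots> = g p (D Y (apply_endo (I r) V) p) (apply_endo (I r) X p)"
    using killing_skew[OF U killing_IV[OF r] IV_vfield[OF r] IX Y p] by simp
  also have "\<dots> = - g p (D Y V p) (I r p (I r p (X p)))"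
    using B[OF Y IX] by (simp add: apply_endo_def)
  also have "\<dots> = g p (D Y V p) (X p)"
    using X Y T g_sym[of "D Y V p" p] tangent_space_lincomb
    by (simp add: I_square[OF r] g_lincomb_right[of "X p" p "X p" "D Y V p" "- 1" 0, simplified])
  also have "\<dots> = - g p (D X V p) (Y p)"
    by (rule killing_skew[OF U killing_V V_vfield Y X p])
  finally show ?thesis .
qed

lemma DV_zero:
  assumes X: "X \<in> vfields A U" and p: "p \<in> U"
  shows "D X V p = (\<lambda>f. 0)"
proof -
  have IX: "apply_endo (I r) X \<in> vfields A U" if "r \<in> {1,2,3}" "X \<in> vfields A U" for r X
    by (rule I_vfield[OF that(1) U that(2)])
  have "g p (D X V p) (Y p) = 0" if Y: "Y \<in> vfields A U" for Y
  proof -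
    let ?J = "\<lambda>r. apply_endo (I r)"
    have swap: "g p (D Z V p) (W p) = - g p (D W V p) (Z p)"
      if "Z \<in> vfields A U" "W \<in> vfields A U" for Z W
      by (rule killing_skew[OF U killing_V V_vfield that p])
    have skew: "g p (D (?J r Z) V p) (?J r W p) = - g p (D Z V p) (W p)"
      if "r \<in> {1,2,3}" "Z \<in> vfields A U" "W \<in> vfields A U" for r Z W
      using DV_I_skew[OF that p] by (simp add: apply_endo_def)
    have J3: "?J 1 (?J 2 Z) p = ?J 3 Z p" if "Z \<in> vfields A U" for Z
      using I_cyclic[of 1 2 3 "Z p" p] vfields_tangent[OF that p] by (simp add: apply_endo_def)
    have "g p (D (?J 1 (?J 2 X)) V p) (?J 1 (?J 2 Y) p) = g p (D X V p) (Y p)"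
      using skew[of 1 "?J 2 X" "?J 2 Y"] skew[of 2 X Y] IX[of 2] X Y by simp
    \<comment> \<open>\<open>J3\<close> equates values at points, so \<open>?J 3\<close> is
      substituted only in the second slot of \<open>g\<close>, which reads a value at
      \<open>p\<close>. Skewness brings the other composite field into that slot.\<close>
    moreover have "g p (D (?J 1 (?J 2 X)) V p) (?J 1 (?J 2 Y) p) = - g p (D X V p) (Y p)"
    proof -
      have "g p (D (?J 1 (?J 2 X)) V p) (?J 1 (?J 2 Y) p) = - g p (D (?J 3 Y) V p) (?J 1 (?J 2 X) p)"
        unfolding J3[OF Y] by (intro swap IX X Y) simp_all
      also have "\<dots> = g p (D Y V p) (X p)" unfolding J3[OF X] using skew[of 3 Y X] X Y by simp
      also have "\<dots> = - g p (D X V p) (Y p)" by (rule swap[OF Y X])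
      finally show ?thesis .
    qed
    ultimately show ?thesis by simp
  qed
  \<comment> \<open>Choosing \<open>Y\<close> to be \<open>D X V\<close> itself, definiteness of
    \<open>g\<close> finishes.\<close>
  from this[OF D_vfield[OF U X V_vfield]] show ?thesis
    by (rule g_definite[OF vfields_tangent[OF D_vfield[OF U X V_vfield] p]])
qed

lemma DIV_zero:
  "r \<in> {1,2,3} \<Longrightarrow> X \<in> vfields A U \<Longrightarrow> p \<in> U \<Longrightarrow> D X (apply_endo (I r) V) p = (\<lambda>f. 0)"
  by (simp add: D_endo[OF U _ _ V_vfield] DV_zero I_zero)

section \<open>Torsion form of the symmetry and the potential equation\<close>

text \<open>Since \<open>I r V\<close> is parallel, only the torsion term of
  \<open>ext_d1_dual_form\<close> survives. Moving \<open>I r V\<close> from the last slot to the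
  first takes two transpositions, hence no sign.\<close>

lemma ext_d1_dual_form_IV:
  assumes "r \<in> {1,2,3}" "X \<in> vfields A U" "Y \<in> vfields A U" "p \<in> U"
  shows "ext_d1 A (dual_form g (apply_endo (I r) V)) X Y p
    = torsion_3form A g D (apply_endo (I r) V) X Y p"
proof -
  note K = IV_vfield[OF assms(1)]
  have "torsion_3form A g D X Y (apply_endo (I r) V) p = torsion_3form A g D (apply_endo (I r) V) X Y p"
    using torsion_3form_alternating(1)[OF U K assms(2,3,4)] torsion_3form_alternating(2)[OF U assms(2) K assms(3,4)]
    by simp
  then show ?thesis
    using assms by (simp add: ext_d1_dual_form[OF U K] DIV_zero g_zero_left vfields_tangent)
qed

lemma lie_bracket_IV:
  assumes "r \<in> {1,2,3}" "X \<in> vfields A U" "p \<in> U"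
  shows "lie_bracket A (apply_endo (I r) V) X p
    = (\<lambda>f. D (apply_endo (I r) V) X p f - torsion A D (apply_endo (I r) V) X p f)"
  using DIV_zero[OF assms] by (simp add: torsion_def)

lemma lie_derivative_IV_I:
  assumes rst: "(r, s, t) \<in> {(1,2,3), (2,3,1), (3,1,2)}" and X: "X \<in> vfields A U" and p: "p \<in> U"
  shows "lie_endo A (apply_endo (I r) V) (I s) X p = I t p (X p)"
proof -
  have r: "r \<in> {1,2,3}" and s: "s \<in> {1,2,3}" using rst by auto
  have "lie_endo A (apply_endo (I r) V) (I s) X p
      = (\<lambda>f. \<Sum>t\<in>{1,2,3}. levi_civita r s t * I t p (X p) f)"
    using symmetry[unfolded D21_symmetry_def, THEN conjunct2, THEN conjunct2, THEN conjunct2, THEN conjunct1,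
        THEN bspec, OF r, THEN bspec, OF s, THEN spec, THEN mp, OF U, THEN bspec, OF X, THEN bspec, OF p] .
  \<comment> \<open>For a cyclic triple exactly one summand is nonzero, with coefficient 1.\<close>
  also have "\<dots> = I t p (X p)" using rst by (elim insertE emptyE; simp add: levi_civita_def)
  finally show ?thesis .
qed

text \<open>
  For a \<open>D\<close>-parallel field \<open>K\<close>, the Lie derivative of a \<open>D\<close>-parallel endomorphism \<open>J\<close> along \<open>K\<close> is the
  commutator of \<open>J\<close> with \<open>T(K, _)\<close>.
\<close>

lemma torsion_3form_IV:
  assumes rst: "(r, s, t) \<in> {(1,2,3::nat), (2,3,1), (3,1,2)}"
    and X: "X \<in> vfields A U" and Y: "Y \<in> vfields A U" and p: "p \<in> U"
  shows "torsion_3form A g D (apply_endo (I r) V) (apply_endo (I s) X) (apply_endo (I s) Y) p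
       - torsion_3form A g D (apply_endo (I r) V) X Y p = g p (I r p (X p)) (Y p)"
proof -
  let ?K = "apply_endo (I r) V" and ?X = "apply_endo (I s) X" and ?Y = "apply_endo (I s) Y"
  have r: "r \<in> {1,2,3}" and s: "s \<in> {1,2,3}" and t: "t \<in> {1,2,3}" using rst by auto
  have srt: "(s, t, r) \<in> {(1,2,3), (2,3,1), (3,1,2)}" using rst by auto
  note K = IV_vfield[OF r] and IX = I_vfield[OF s U X] and IY = I_vfield[OF s U Y]
  note Tp = torsion_tangent[OF U K _ p]
  note Dp = vfields_tangent[OF D_vfield[OF U K X] p]
  have Xp: "X p \<in> tangent_space A p" and Yp: "Y p \<in> tangent_space A p"
    using vfields_tangent X Y p by auto
  \<comment> \<open>The covariant terms of the two brackets cancel because \<open>I s\<close> is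
    parallel, leaving the commutator with the torsion.\<close>
  have "I t p (X p) f = I s p (torsion A D ?K X p) f - torsion A D ?K ?X p f" for f
  proof -
    have "I t p (X p) f = lie_bracket A ?K ?X p f - I s p (lie_bracket A ?K X p) f"
      using lie_derivative_IV_I[OF rst X p] by (metis lie_endo_def)
    moreover have "I s p (lie_bracket A ?K X p) f = I s p (D ?K X p) f - I s p (torsion A D ?K X p) f"
      unfolding lie_bracket_IV[OF r X p] using I_lincomb[OF s Dp Tp[OF X], of 1 "- 1"] by simp
    ultimately show ?thesis
      unfolding lie_bracket_IV[OF r IX p] by (simp add: D_endo[OF U s K X p])
  qed
  then have "g p (I t p (X p)) (?Y p) = g p (\<lambda>f. I s p (torsion A D ?K X p) f - torsion A D ?K ?X p f) (?Y p)"
    by presburger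
  also have "\<dots> = g p (torsion A D ?K X p) (Y p) - torsion_3form A g D ?K ?X ?Y p"
    using g_diff_left[OF I_tangent[OF s Tp[OF X]] Tp[OF IX] vfields_tangent[OF IY p]]
      g_I[OF s Tp[OF X] Yp]
    by (simp add: torsion_3form_def apply_endo_def)
  finally have "g p (I t p (X p)) (I s p (Y p))
      = torsion_3form A g D ?K X Y p - torsion_3form A g D ?K ?X ?Y p"
    by (simp add: torsion_3form_def apply_endo_def)
  \<comment> \<open>Skew-adjointness moves \<open>I s\<close> to the left, where the shifted cyclic
    triple gives \<open>I s I t = I r\<close>.\<close>
  moreover have "g p (I t p (X p)) (I s p (Y p)) = - g p (I r p (X p)) (Y p)"
    using g_I_left[OF s I_tangent[OF t Xp] Yp] I_cyclic[OF srt Xp] by simp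
  ultimately show ?thesis by simp
qed

text \<open>Half the exterior derivative of \<open>\<alpha>\<close> is minus the torsion form at
  \<open>I r V, X, Y\<close>, and half the twisted derivative of \<open>\<beta>\<close> is the same
  form with \<open>I s\<close> applied to \<open>X\<close> and \<open>Y\<close>;
  \<open>torsion_3form_IV\<close> evaluates their sum. Leaving \<open>\<alpha>\<close> and
  \<open>\<beta>\<close> general lets the lemma serve both the potential 1-form and the potential
  functions.\<close>

lemma potential_equation:
  assumes rst: "(r, s, t) \<in> {(1,2,3), (2,3,1), (3,1,2)}"
    and X: "X \<in> vfields A U" and Y: "Y \<in> vfields A U" and p: "p \<in> U"
    and \<alpha>: "\<And>Z q. Z \<in> vfields A U \<Longrightarrow> q \<in> U \<Longrightarrow> \<alpha> Z q = - 2 * dual_form g (apply_endo (I r) V) Z q"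
    and \<beta>: "\<And>Z q. Z \<in> vfields A U \<Longrightarrow> q \<in> U \<Longrightarrow> \<beta> Z q = - 2 * dual_form g (apply_endo (I t) V) Z q"
  shows "fundamental_form g (I r) X Y p = 1 / 2 * (ext_d1 A \<alpha> X Y p + twisted_d1 A (I s) \<beta> X Y p)"
proof -
  let ?K = "apply_endo (I r) V" and ?X = "apply_endo (I s) X" and ?Y = "apply_endo (I s) Y"
  have r: "r \<in> {1,2,3}" and s: "s \<in> {1,2,3}" and t: "t \<in> {1,2,3}" using rst by auto
  have srt: "(s, t, r) \<in> {(1,2,3), (2,3,1), (3,1,2)}" using rst by auto
  note K = IV_vfield[OF r] and IX = I_vfield[OF s U X] and IY = I_vfield[OF s U Y]
  have d: "ext_d1 A \<gamma> X Y p = - 2 * torsion_3form A g D ?K X Y p"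
    if "X \<in> vfields A U" "Y \<in> vfields A U"
      "\<And>Z q. Z \<in> vfields A U \<Longrightarrow> q \<in> U \<Longrightarrow> \<gamma> Z q = - 2 * dual_form g ?K Z q" for \<gamma> X Y
    using ext_d1_cong[OF U that(1,2) p that(3)] ext_d1_cmult_dual_form[OF U K that(1,2) p, of "- 2"]
      ext_d1_dual_form_IV[OF r that(1,2) p] by simp
  \<comment> \<open>Acting with \<open>I s\<close> on the dual form of \<open>I t V\<close> returns
    the dual form of \<open>I r V\<close>, so both halves of the equation involve the same field
    \<open>?K\<close>.\<close>
  have "act_form1 (I s) \<beta> Z q = - 2 * dual_form g ?K Z q" if Z: "Z \<in> vfields A U" and q: "q \<in> U" for Z q
  proof -
    have T: "V q \<in> tangent_space A q" "Z q \<in> tangent_space A q"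
      using vfields_tangent V_vfield[of U] Z q by auto
    have "act_form1 (I s) \<beta> Z q = 2 * g q (I t q (V q)) (I s q (Z q))"
      using \<beta>[OF I_vfield[OF s U Z] q] by (simp add: act_form1_def dual_form_def apply_endo_def)
    also have "\<dots> = - 2 * g q (I r q (V q)) (Z q)"
      using g_I_left[OF s I_tangent[OF t T(1)] T(2)] I_cyclic[OF srt T(1)] by simp
    finally show ?thesis by (simp add: dual_form_def apply_endo_def)
  qed
  then have "twisted_d1 A (I s) \<beta> X Y p = 2 * torsion_3form A g D ?K ?X ?Y p"
    using d[OF IX IY, of "act_form1 (I s) \<beta>"] by (simp add: twisted_d1_def act_form2_def)
  then show ?thesis
    using d[OF X Y \<alpha>] torsion_3form_IV[OF rst X Y p] by (simp add: fundamental_form_def)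
qed

end

section \<open>The potential 1-form\<close>

abbreviation \<omega> :: "'m form1" where
  "\<omega> \<equiv> \<lambda>X p. - 2 * dual_form g V X p"

lemma act_form1_\<omega>:
  assumes r: "r \<in> {1,2,3}" and U: "open U" "Z \<in> vfields A U" "q \<in> U"
  shows "act_form1 (I r) \<omega> Z q = - 2 * dual_form g (apply_endo (I r) V) Z q"
  using g_I_left[OF r vfields_tangent[OF V_vfield U(3)] vfields_tangent[OF U(2,3)]]
  by (simp add: act_form1_def dual_form_def apply_endo_def)

lemma one_form_\<omega>: "one_form A \<omega>"
  unfolding one_form_def
proof (intro allI impI ballI conjI)
  fix U X Y h
  assume U: "open U" and X: "X \<in> vfields A U" and Y: "Y \<in> vfields A U" and "h \<in> smooth_funs A U"
  show "\<omega> X \<in> smooth_funs A U"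
    unfolding dual_form_def by (intro smooth_funs_mult U smooth_funs_const g_smooth X V_vfield)
  fix p assume p: "p \<in> U"
  show "\<omega> (\<lambda>q f. h q * X q f + Y q f) p = h p * \<omega> X p + \<omega> Y p"
    using g_lincomb_right[OF vfields_tangent[OF X p] vfields_tangent[OF Y p] vfields_tangent[OF V_vfield p], of "h p" 1]
    by (simp add: dual_form_def algebra_simps)
qed (simp add: dual_form_def)

lemma potential_1form_\<omega>: "potential_1form A g I \<omega>"
  unfolding potential_1form_def form2_eq_on_def
proof (intro conjI one_form_\<omega> ballI, clarify)
  fix r s t W X Y p
  assume rst: "(r, s, t) \<in> {(1::nat,2::nat,3::nat), (2,3,1), (3,1,2)}"
    and W: "open W" and X: "X \<in> vfields A W" and Y: "Y \<in> vfields A W" and p: "p \<in> W"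
  have "r \<in> {1,2,3}" "t \<in> {1,2,3}" using rst by auto
  then show "fundamental_form g (I r) X Y p = 1 / 2 *
      (ext_d1 A (act_form1 (I r) \<omega>) X Y p + twisted_d1 A (I s) (act_form1 (I t) \<omega>) X Y p)"
    by (intro potential_equation[OF W rst X Y p] act_form1_\<omega>[OF _ W])
qed

text \<open>With \<open>g\<close> parallel, the covariant derivative of the dual form is the dual
  form of the derivative of \<open>V\<close>, which vanishes by \<open>DV_zero\<close>.\<close>

lemma parallel_\<omega>: "parallel_form1 A D \<omega>"
  unfolding parallel_form1_def
proof (intro allI impI ballI)
  fix U X Y p
  assume U: "open U" and X: "X \<in> vfields A U" and Y: "Y \<in> vfields A U" and p: "p \<in> U"
  have "X p (\<omega> Y) = - 2 * X p (\<lambda>q. g q (V q) (Y q))"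
    unfolding dual_form_def
    by (rule tvec_cmult[OF vfields_tangent[OF X p] smooth_nearI[OF U p g_smooth[OF U V_vfield Y]]])
  then show "X p (\<omega> Y) - \<omega> (D X Y) p = 0"
    using D_metric[OF U X V_vfield Y p] DV_zero[OF U X p] g_zero_left[OF vfields_tangent[OF Y p]]
    by (simp add: dual_form_def)
qed

section \<open>Local potential functions\<close>

text \<open>The closed form is written in a chart, integrated by \<open>poincare_1form\<close> on a
  coordinate ball and pulled back. The conclusion says that its differential is \<open>-2\<close>
  times the dual form of \<open>V\<close>, evaluated on single tangent vectors.\<close>

lemma local_primitive:
  obtains U \<mu> where "open U" "p \<in> U" "\<mu> \<in> smooth_funs A U"
    "\<And>q u. q \<in> U \<Longrightarrow> u \<in> tangent_space A q \<Longrightarrow> u \<mu> = - 2 * g q (V q) u"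
proof -
  obtain W \<phi> where c: "(W, \<phi>) \<in> A" "p \<in> W" by (rule chart_at)
  let ?E = "\<lambda>v q. coord_tvec A (W, \<phi>) q v"
  obtain r where r: "r > 0" "ball (\<phi> p) r \<subseteq> \<phi> ` W"
    using open_chart_image[OF c(1)] c(2) open_contains_ball by blast
  \<comment> \<open>A ball provides the convexity needed for \<open>poincare_1form\<close>.\<close>
  define B where "B = ball (\<phi> p) r"
  define U where "U = {q \<in> W. \<phi> q \<in> B}"
  have oB: "open B" by (simp add: B_def)
  have U: "open U" unfolding U_def B_def by (rule open_chart_preimage[OF c(1) open_ball])
  have UW: "U \<subseteq> W" and pU: "p \<in> U" using c(2) r by (auto simp: U_def B_def)
  have \<phi>U: "\<phi> ` U = B" using r(2) by (auto simp: U_def B_def)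
  have inv_U: "inv_into W \<phi> x \<in> U" and \<phi>_inv: "\<phi> (inv_into W \<phi> x) = x" if "x \<in> B" for x
    using that chart_inv[OF c(1)] UW unfolding \<phi>U[symmetric] by force+
  have E: "?E v \<in> vfields A U" for v using vfields_mono[OF coord_vfield[OF c(1)] UW] .
  \<comment> \<open>The coordinate expression of \<open>\<omega>\<close>: its value at the point
    with coordinates \<open>x\<close> on the constant coordinate field \<open>v\<close>.\<close>
  define a where "a x v = - 2 * g (inv_into W \<phi> x) (V (inv_into W \<phi> x)) (?E v (inv_into W \<phi> x))" for x v
  have a\<phi>: "a (\<phi> q) v = - 2 * dual_form g V (?E v) q" if "q \<in> U" for q v
    using that UW chart_inv[OF c(1)] by (auto simp: a_def dual_form_def)
  have \<theta>_smooth: "dual_form g V (?E v) \<in> smooth_funs A U" for v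
    unfolding dual_form_def[abs_def] by (rule g_smooth[OF U V_vfield E])
  have a_smooth: "smooth_on B (\<lambda>x. a x v)" for v
  proof -
    have "smooth_on (\<phi> ` (W \<inter> U)) (\<lambda>x. dual_form g V (?E v) (inv_into W \<phi> x))"
      using smooth_fun_chart[OF \<theta>_smooth c(1)] by (simp add: o_def)
    then have "smooth_on B (\<lambda>x. dual_form g V (?E v) (inv_into W \<phi> x))"
      using \<phi>U UW by (simp add: Int_absorb1)
    from smooth_on_mult[OF oB smooth_on_const[of _ "- 2"] this] show ?thesis
      by (simp add: a_def dual_form_def)
  qed
  have a_linear: "linear (a x)" if "x \<in> B" for x
  proof -
    let ?q = "inv_into W \<phi> x"
    have q: "?q \<in> W" using inv_U[OF that] UW by blast
    note T = coord_tvec_in[OF c(1) q] and Vq = vfields_tangent[OF V_vfield inv_U[OF that]]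
    have lin: "?E (b *\<^sub>R v + b' *\<^sub>R w) ?q = (\<lambda>f. b * ?E v ?q f + b' * ?E w ?q f)" for b b' v w
      by (rule coord_tvec_lincomb[OF c(1) q])
    show ?thesis
    proof (rule linearI)
      show "a x (v + w) = a x v + a x w" for v w
        using lin[of 1 v 1 w] g_lincomb_right[OF T T Vq, of 1 v 1 w] by (simp add: a_def)
      show "a x (b *\<^sub>R v) = b *\<^sub>R a x v" for b v
        using lin[of b v 0 v] g_lincomb_right[OF T T Vq, of b v 0 v] by (simp add: a_def)
    qed
  qed
  have a_closed: "frechet_derivative (\<lambda>y. a y v) (at x) w = frechet_derivative (\<lambda>y. a y w) (at x) v"
    if x: "x \<in> B" for x v w
  proof -
    let ?q = "inv_into W \<phi> x"
    have q: "?q \<in> U" "?q \<in> W" using inv_U[OF x] UW by auto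
    have E_\<theta>: "frechet_derivative (\<lambda>y. a y v) (at x) w = - 2 * ?E w ?q (dual_form g V (?E v))" for v w
    proof -
      have "?E w ?q (\<lambda>q. - 2 * dual_form g V (?E v) q) = frechet_derivative (\<lambda>y. a y v) (at x) w"
      proof (rule coord_tvec_eq[OF _ c(1) q(2)])
        show "smooth_near A ?q (\<lambda>q. - 2 * dual_form g V (?E v) q)"
          by (rule smooth_nearI[OF U q(1) smooth_funs_mult[OF U smooth_funs_const \<theta>_smooth]])
        show "((\<lambda>x. - 2 * dual_form g V (?E v) (inv_into W \<phi> x)) has_derivative
            frechet_derivative (\<lambda>y. a y v) (at x)) (at (\<phi> ?q))"
          using smooth_on_has_derivative[OF a_smooth[of v] x] by (simp add: \<phi>_inv[OF x] a_def dual_form_def)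
      qed
      then show ?thesis
        using tvec_cmult[OF coord_tvec_in[OF c(1) q(2)] smooth_nearI[OF U q(1) \<theta>_smooth], of w "- 2" v] by simp
    qed
    \<comment> \<open>Coordinate fields have zero bracket, so closedness on them is just the
      symmetry of partial derivatives of the coefficients.\<close>
    have "ext_d1 A (dual_form g V) (?E v) (?E w) ?q = 0" by (rule dual_form_closed[OF U E E q(1)])
    moreover have "g ?q (V ?q) (\<lambda>f. 0) = 0"
      using g_lincomb_right[OF tangent_space_zero tangent_space_zero vfields_tangent[OF V_vfield q(1)], of 0 0] by simp
    ultimately have "?E v ?q (dual_form g V (?E w)) = ?E w ?q (dual_form g V (?E v))"
      by (simp add: ext_d1_def dual_form_def lie_bracket_coord_vfields[OF c(1) q(2)])
    then show ?thesis by (simp only: E_\<theta>)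
  qed
  obtain m where m: "\<And>x. x \<in> B \<Longrightarrow> (m has_derivative a x) (at x)"
    using poincare_1form[of B "\<phi> p" a, OF _ _ _ a_linear a_smooth a_closed] r(1) unfolding B_def by auto
  have m_smooth: "smooth_on (\<phi> ` U) m"
    unfolding \<phi>U by (rule smooth_onI_has_derivative[OF oB m a_smooth])
  have \<mu>_smooth: "(\<lambda>q. m (\<phi> q)) \<in> smooth_funs A U" by (rule smooth_funs_pullback[OF c(1) U UW m_smooth])
  show ?thesis
  proof (rule that[OF U pU \<mu>_smooth])
    fix q u assume q: "q \<in> U" and u: "u \<in> tangent_space A q"
    have qW: "q \<in> W" and \<phi>q: "\<phi> q \<in> B" using q \<phi>U UW by auto
    obtain v where v: "u = ?E v q" using tangent_space_chart_change[OF u c(1) qW] .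
    have "((\<lambda>x. m (\<phi> (inv_into W \<phi> x))) has_derivative a (\<phi> q)) (at (\<phi> q))"
      by (rule has_derivative_transform_within_open[OF m[OF \<phi>q] oB \<phi>q]) (simp add: \<phi>_inv)
    from coord_tvec_eq[OF smooth_nearI[OF U q \<mu>_smooth] c(1) qW this, of v]
    show "u (\<lambda>q. m (\<phi> q)) = - 2 * g q (V q) u" by (simp add: v a\<phi>[OF q] dual_form_def)
  qed
qed

text \<open>On \<open>U\<close> the differential of \<open>\<mu>\<close> is \<open>\<omega>\<close>,
  so each \<open>twisted_d0 (I r) \<mu>\<close> agrees there with
  \<open>act_form1 (I r) \<omega>\<close>, and \<open>potential_equation\<close> applies over every
  open subset of \<open>U\<close>.\<close>

lemma local_potential: "\<exists>U \<mu>. open U \<and> p \<in> U \<and> potential_function A g I U \<mu>"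
proof -
  obtain U \<mu> where U: "open U" "p \<in> U" "\<mu> \<in> smooth_funs A U"
    and \<mu>: "\<And>q u. q \<in> U \<Longrightarrow> u \<in> tangent_space A q \<Longrightarrow> u \<mu> = - 2 * g q (V q) u"
    using local_primitive[of p] by blast
  have eq: "twisted_d0 (I r) \<mu> Z q = - 2 * dual_form g (apply_endo (I r) V) Z q"
    if "r \<in> {1,2,3}" "open W" "W \<subseteq> U" "Z \<in> vfields A W" "q \<in> W" for r W Z q
    using \<mu>[of q "I r q (Z q)"] I_tangent[OF that(1) vfields_tangent[OF that(4,5)]] that
      act_form1_\<omega>[OF that(1,2,4,5)]
    by (auto simp: twisted_d0_def act_form1_def ext_d0_def dual_form_def apply_endo_def)
  have "potential_function A g I U \<mu>"
    unfolding potential_function_def form2_eq_on_def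
  proof (intro conjI U ballI, clarify)
    fix r s t W X Y p
    assume rst: "(r, s, t) \<in> {(1::nat,2::nat,3::nat), (2,3,1), (3,1,2)}"
      and W: "open W" "W \<subseteq> U" and X: "X \<in> vfields A W" and Y: "Y \<in> vfields A W" and p: "p \<in> W"
    have "r \<in> {1,2,3}" "t \<in> {1,2,3}" using rst by auto
    then show "fundamental_form g (I r) X Y p = 1 / 2 *
        (ext_d1 A (twisted_d0 (I r) \<mu>) X Y p + twisted_d1 A (I s) (twisted_d0 (I t) \<mu>) X Y p)"
      by (intro potential_equation[OF W(1) rst X Y p] eq[OF _ W])
  qed
  then show ?thesis using U by blast
qed

end

theorem proposition11:
  fixes A :: "('m::{t2_space, second_countable_topology}, 'e::euclidean_space) chart set"
    and g :: "'m metric" and I :: "nat \<Rightarrow> 'm endo"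
    and D :: "'m connection" and V :: "'m vfield"
  assumes "hkt_manifold A g I"
    and "hkt_connection A g I D"
    and "D21_symmetry A g I V"
  shows "potential_1form A g I (\<lambda>X p. - 2 * dual_form g V X p)
    \<and> parallel_form1 A D (\<lambda>X p. - 2 * dual_form g V X p)
    \<and> (\<forall>p. \<exists>U \<mu>. open U \<and> p \<in> U \<and> potential_function A g I U \<mu>)"
proof -
  interpret hkt_symmetry A g I D V
    using assms by unfold_locales (auto simp: hkt_manifold_def)
  show ?thesis using potential_1form_\<omega> parallel_\<omega> local_potential by blast
qed

end
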